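(* Let $G$ be a group and let $X$ be a uniform bornological coarse space with an action of $G$ by automorphisms. Assume that $G$ is countable and that the $G$-action on $X$ is uniformly free. If $V$ is a $G$-adapted coarse entourage of $\mathrm{Sq}(X)$, then the map $$f:(G\ltimes\mathrm{Sq}(X)_V)//G\to\mathrm{Sq}(X)_V//G,\qquad (g,n,x)\mapsto(n,g^{-1}x)$$ is a branched coarse $G$-covering with respect to the big family $((-\infty,n]\times X)_{n\in\mathbb{N}}$.
   Context: **Spaces.** Entourages are subsets of $X\times X$; $U^l$ denotes the $l$-fold composition, $gU:=(g\times g)(U)$, $U[B]:=\{x\mid\exists b\in B:(x,b)\in U\}$. A bornological coarse space is a set with a bornology (bounded subsets: closed under subsets and finite unions, covering the set) and a coarse structure (entourages: containing the diagonal, closed under subsets, finite unions, inverses, compositions) such that $U[B]$ is bounded for $U$ coarse, $B$ bounded. A map is controlled if it sends coarse entourages to coarse entourages, and proper if preimages of bounded sets are bounded; these are the morphisms of $\mathbf{BC}$. A uniform bornological coarse space has in addition a uniform structure such that some coarse entourage is also uniform; its automorphisms are uniform, proper and controlled in both directions. A $G$-bornological coarse space is a bornological coarse space with $G$-action by automorphisms such that every coarse entourage is contained in a $G$-invariant one. A big family is a filtered increasing family $(Z_i)$ of subsets such that for all $i$ and coarse $U$ there is $j$ with $U[Z_i]\subseteq Z_j$. $X_U$ denotes $X$ with coarse structure generated by the single entourage $U$. **Squeezing space.** $\mathrm{Sq}(X)$ is the set $\mathbb{Z}\times X$ with bornology generated by $F\times B$ ($F$ finite, $B$ bounded) and coarse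 structure consisting of all subsets of entourages $(\mathrm{diag}(\mathbb{Z})\times U)\cap W$, where $U$ is coarse on $X$ and $W$ is such that for every uniform entourage $V'$ of $X$ there is $n_0$ with $W_n:=W\cap(\{n\}\times X)^2\subseteq V'$ for all $n\ge n_0$. $G$ acts by $g(n,x)=(n,gx)$. **Conditions.** The action on $X$ is uniformly free if for every $g\ne e$ there is a uniform entourage $U$ of $X$ with $U\cap\{(gx,x)\mid x\in X\}=\emptyset$. A uniform scale on $X$ is a family $(U_n)_{n\in\mathbb{N}}$ of uniform entourages cofinal in the uniform structure (every uniform entourage contains $U_n$ for all sufficiently large $n$). A coarse entourage $V$ of $\mathrm{Sq}(X)$ (with components $V_n$ on $\{n\}\times X$) is uniformly wide if $(V_n)_{n\in\mathbb{N}}$ is a uniform scale and there is a coarse entourage $U$ of $X$ which is also uniform with $V_n=U$ for all $n\le0$. $V$ is $G$-adapted if it is symmetric, uniformly wide, and for every $g\in G$ there is $k\in\mathbb{N}$ such that $gV^l\subseteq V^{lk}$ for all $l\in\mathbb{N}$. In this case $G$ acts on $\mathrm{Sq}(X)_V$ by automorphisms. **Quotient and $G\ltimes-$.** For a bornological coarse space $Y$ with $G$-action by automorphisms, $Y//G$ is $Y$ with the same bornology and the coarse structure generated by that of $Y$ and the entourages $\{(gy,y)\mid y\in Y\}$, $g\in G$. $G\ltimes Y$ is the set $G\times Y$ with the diagonal $G$-action (left multiplication on $G$), coarse structure generated by the entourages $W_G:=(f\times f)^{-1}(W)\cap(\mathrm{pr}_G\times\mathrm{pr}_G)^{-1}(\mathrm{diag}(G))$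 for all coarse entourages $W$ of $Y$, where $f(g,y)=g^{-1}y$, and bornology generated by $F\times B$ ($F\subseteq G$ finite, $B$ bounded). It has an additional commuting $G$-action by right multiplication on the factor $G$ (such that $f$ intertwines it with the action on $Y$); $(G\ltimes Y)//G$ is the quotient with respect to this additional action and is a $G$-bornological coarse space via the diagonal action. $Y//G$ carries the trivial $G$-action. **Branched coarse $G$-covering.** Let $A$ be a $G$-bornological coarse space, $B$ a bornological coarse space with big family $\mathcal{Z}$ and trivial $G$-action, $f:A\to B$ a $G$-equivariant map of sets. $f$ is a branched coarse $G$-covering with respect to $\mathcal{Z}$ if $f$ is controlled, bornological (bounded sets have bounded images), has locally finite fibres (fibres meet bounded sets in finite sets), and there is a $G$-invariant entourage $P$ on $A$ such that: (1) for every coarse entourage $V$ of $B$ there is $Z\in\mathcal{Z}$ such that for every $(b',b)\in V\cap(B\times(B\setminus Z))$ and $a\in f^{-1}(b)$ there is a unique $a'\in f^{-1}(b')$ with $(a',a)\in P$, and $P\cap(f\times f)^{-1}(V\cap(B\times(B\setminus Z)))$ is a coarse entourage of $A$; (2) for every coarse entourage $U$ of $A$ there is $Z\in\mathcal{Z}$ with $U\cap(A\times f^{-1}(B\setminus Z))\subseteq P$. *)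

theory Defs
  imports "HOL-Algebra.Group_Action" "HOL-Library.Countable_Set" "HOL.Hull"
begin

section \<open>Bornological coarse spaces\<close>

record 'a bc_space = "'a partial_object" +
  bornology :: "'a set set"
  coarse :: "'a rel set"

record 'a ubc_space = "'a bc_space" +
  uniform_ents :: "'a rel set"

definition bornology_on :: "'a set \<Rightarrow> 'a set set \<Rightarrow> bool" where
  "bornology_on X \<B> \<longleftrightarrow>
     \<B> \<subseteq> Pow X \<and> {} \<in> \<B> \<and> \<Union>\<B> = X \<and>
     (\<forall>B\<in>\<B>. \<forall>B'. B' \<subseteq> B \<longrightarrow> B' \<in> \<B>) \<and>
     (\<forall>B\<in>\<B>. \<forall>B'\<in>\<B>. B \<union> B' \<in> \<B>)"

definition coarse_structure_on :: "'a set \<Rightarrow> 'a rel set \<Rightarrow> bool" where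
  "coarse_structure_on X \<C> \<longleftrightarrow>
     \<C> \<subseteq> Pow (X \<times> X) \<and> Id_on X \<in> \<C> \<and>
     (\<forall>U\<in>\<C>. \<forall>U'. U' \<subseteq> U \<longrightarrow> U' \<in> \<C>) \<and>
     (\<forall>U\<in>\<C>. \<forall>U'\<in>\<C>. U \<union> U' \<in> \<C>) \<and>
     (\<forall>U\<in>\<C>. U\<inverse> \<in> \<C>) \<and>
     (\<forall>U\<in>\<C>. \<forall>U'\<in>\<C>. U O U' \<in> \<C>)"

definition uniform_structure_on :: "'a set \<Rightarrow> 'a rel set \<Rightarrow> bool" where
  "uniform_structure_on X \<U> \<longleftrightarrow>
     \<U> \<subseteq> Pow (X \<times> X) \<and> X \<times> X \<in> \<U> \<and>
     (\<forall>U\<in>\<U>. Id_on X \<subseteq> U) \<and>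
     (\<forall>U\<in>\<U>. \<forall>U'. U \<subseteq> U' \<and> U' \<subseteq> X \<times> X \<longrightarrow> U' \<in> \<U>) \<and>
     (\<forall>U\<in>\<U>. \<forall>U'\<in>\<U>. U \<inter> U' \<in> \<U>) \<and>
     (\<forall>U\<in>\<U>. U\<inverse> \<in> \<U>) \<and>
     (\<forall>U\<in>\<U>. \<exists>W\<in>\<U>. W O W \<subseteq> U)"

text \<open>Generated structures are hulls: the smallest bornology, respectively coarse structure, on
  \<open>X\<close> containing a given collection.\<close>

abbreviation bornology_generated :: "'a set \<Rightarrow> 'a set set \<Rightarrow> 'a set set" where
  "bornology_generated X \<S> \<equiv> bornology_on X hull \<S>"

abbreviation coarse_generated :: "'a set \<Rightarrow> 'a rel set \<Rightarrow> 'a rel set" where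
  "coarse_generated X \<S> \<equiv> coarse_structure_on X hull \<S>"

definition thickening :: "'a rel \<Rightarrow> 'a set \<Rightarrow> 'a set" where
  "thickening U B = {x. \<exists>b\<in>B. (x, b) \<in> U}"

definition bornological_coarse :: "('a, 'm) bc_space_scheme \<Rightarrow> bool" where
  "bornological_coarse X \<longleftrightarrow>
     bornology_on (carrier X) (bornology X) \<and>
     coarse_structure_on (carrier X) (coarse X) \<and>
     (\<forall>U\<in>coarse X. \<forall>B\<in>bornology X. thickening U B \<in> bornology X)"

definition uniform_bornological_coarse :: "('a, 'm) ubc_space_scheme \<Rightarrow> bool" where
  "uniform_bornological_coarse X \<longleftrightarrow>
     bornological_coarse X \<and>
     uniform_structure_on (carrier X) (uniform_ents X) \<and>
     coarse X \<inter> uniform_ents X \<noteq> {}"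

definition controlled ::
    "('a, 'm) bc_space_scheme \<Rightarrow> ('b, 'n) bc_space_scheme \<Rightarrow> ('a \<Rightarrow> 'b) \<Rightarrow> bool" where
  "controlled X Y f \<longleftrightarrow> (\<forall>U\<in>coarse X. map_prod f f ` U \<in> coarse Y)"

definition proper_map ::
    "('a, 'm) bc_space_scheme \<Rightarrow> ('b, 'n) bc_space_scheme \<Rightarrow> ('a \<Rightarrow> 'b) \<Rightarrow> bool" where
  "proper_map X Y f \<longleftrightarrow> (\<forall>B\<in>bornology Y. f -` B \<inter> carrier X \<in> bornology X)"

definition bornological_map ::
    "('a, 'm) bc_space_scheme \<Rightarrow> ('b, 'n) bc_space_scheme \<Rightarrow> ('a \<Rightarrow> 'b) \<Rightarrow> bool" where
  "bornological_map X Y f \<longleftrightarrow> (\<forall>B\<in>bornology X. f ` B \<in> bornology Y)"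

definition uniform_map ::
    "('a, 'm) ubc_space_scheme \<Rightarrow> ('b, 'n) ubc_space_scheme \<Rightarrow> ('a \<Rightarrow> 'b) \<Rightarrow> bool" where
  "uniform_map X Y f \<longleftrightarrow>
     (\<forall>U\<in>uniform_ents Y. map_prod f f -` U \<inter> (carrier X \<times> carrier X) \<in> uniform_ents X)"

definition bc_morphism ::
    "('a, 'm) bc_space_scheme \<Rightarrow> ('b, 'n) bc_space_scheme \<Rightarrow> ('a \<Rightarrow> 'b) \<Rightarrow> bool" where
  "bc_morphism X Y f \<longleftrightarrow>
     f \<in> carrier X \<rightarrow> carrier Y \<and> controlled X Y f \<and> proper_map X Y f"

definition bc_automorphism :: "('a, 'm) bc_space_scheme \<Rightarrow> ('a \<Rightarrow> 'a) \<Rightarrow> bool" where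
  "bc_automorphism X f \<longleftrightarrow>
     bij_betw f (carrier X) (carrier X) \<and>
     bc_morphism X X f \<and> bc_morphism X X (inv_into (carrier X) f)"

definition ubc_automorphism :: "('a, 'm) ubc_space_scheme \<Rightarrow> ('a \<Rightarrow> 'a) \<Rightarrow> bool" where
  "ubc_automorphism X f \<longleftrightarrow>
     bc_automorphism X f \<and> uniform_map X X f \<and> uniform_map X X (inv_into (carrier X) f)"

definition translate :: "('g \<Rightarrow> 'a \<Rightarrow> 'a) \<Rightarrow> 'g \<Rightarrow> 'a rel \<Rightarrow> 'a rel" where
  "translate \<alpha> g U = map_prod (\<alpha> g) (\<alpha> g) ` U"

definition invariant_rel ::
    "('g, 'k) monoid_scheme \<Rightarrow> ('g \<Rightarrow> 'a \<Rightarrow> 'a) \<Rightarrow> 'a rel \<Rightarrow> bool" where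
  "invariant_rel G \<alpha> U \<longleftrightarrow> (\<forall>g\<in>carrier G. translate \<alpha> g U = U)"

definition G_bornological_coarse ::
    "('g, 'k) monoid_scheme \<Rightarrow> ('a, 'm) bc_space_scheme \<Rightarrow> ('g \<Rightarrow> 'a \<Rightarrow> 'a) \<Rightarrow> bool" where
  "G_bornological_coarse G X \<alpha> \<longleftrightarrow>
     bornological_coarse X \<and> group_action G (carrier X) \<alpha> \<and>
     (\<forall>g\<in>carrier G. bc_automorphism X (\<alpha> g)) \<and>
     (\<forall>U\<in>coarse X. \<exists>U'\<in>coarse X. U \<subseteq> U' \<and> invariant_rel G \<alpha> U')"

definition big_family :: "('a, 'm) bc_space_scheme \<Rightarrow> ('i::order \<Rightarrow> 'a set) \<Rightarrow> bool" where
  "big_family X Z \<longleftrightarrow>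
     (\<forall>i j. \<exists>k::'i. i \<le> k \<and> j \<le> k) \<and> mono Z \<and> (\<forall>i. Z i \<subseteq> carrier X) \<and>
     (\<forall>i. \<forall>U\<in>coarse X. \<exists>j. thickening U (Z i) \<subseteq> Z j)"

definition coarsely_generated_by ::
    "('a, 'm) bc_space_scheme \<Rightarrow> 'a rel \<Rightarrow> ('a, 'm) bc_space_scheme" where
  "coarsely_generated_by X U = X\<lparr>coarse := coarse_generated (carrier X) {U}\<rparr>"


section \<open>The squeezing space\<close>

definition slice :: "(int \<times> 'a) rel \<Rightarrow> int \<Rightarrow> 'a rel" where
  "slice W n = {(x, y). ((n, x), (n, y)) \<in> W}"

definition diag_times :: "'a rel \<Rightarrow> (int \<times> 'a) rel" where
  "diag_times U = {((n, x), (n, y)) | n x y. (x, y) \<in> U}"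

definition squeezing :: "('a, 'm) ubc_space_scheme \<Rightarrow> (int \<times> 'a) bc_space" where
  "squeezing X =
     \<lparr>carrier = UNIV \<times> carrier X,
      bornology = bornology_generated (UNIV \<times> carrier X)
        {F \<times> B | F B. finite F \<and> B \<in> bornology X},
      coarse = {E. \<exists>U\<in>coarse X. \<exists>W \<subseteq> (UNIV \<times> carrier X) \<times> (UNIV \<times> carrier X).
        (\<forall>V'\<in>uniform_ents X. \<exists>n0. \<forall>n\<ge>n0. slice W n \<subseteq> V') \<and> E \<subseteq> diag_times U \<inter> W}\<rparr>"

text \<open>Actions in the sense of \<open>group_action\<close> are extensional, hence the restriction to the
  underlying set here and below.\<close>

definition squeezing_action ::
    "('a, 'm) ubc_space_scheme \<Rightarrow> ('g \<Rightarrow> 'a \<Rightarrow> 'a) \<Rightarrow> 'g \<Rightarrow> int \<times> 'a \<Rightarrow> int \<times> 'a" where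
  "squeezing_action X \<alpha> g = (\<lambda>(n, x)\<in>UNIV \<times> carrier X. (n, \<alpha> g x))"

definition uniformly_free ::
    "('g, 'k) monoid_scheme \<Rightarrow> ('a, 'm) ubc_space_scheme \<Rightarrow> ('g \<Rightarrow> 'a \<Rightarrow> 'a) \<Rightarrow> bool" where
  "uniformly_free G X \<alpha> \<longleftrightarrow>
     (\<forall>g\<in>carrier G. g \<noteq> \<one>\<^bsub>G\<^esub> \<longrightarrow>
        (\<exists>U\<in>uniform_ents X. U \<inter> {(\<alpha> g x, x) | x. x \<in> carrier X} = {}))"

definition uniform_scale :: "('a, 'm) ubc_space_scheme \<Rightarrow> (nat \<Rightarrow> 'a rel) \<Rightarrow> bool" where
  "uniform_scale X S \<longleftrightarrow>
     (\<forall>n. S n \<in> uniform_ents X) \<and>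
     (\<forall>U\<in>uniform_ents X. \<exists>n0. \<forall>n\<ge>n0. S n \<subseteq> U)"

definition uniformly_wide :: "('a, 'm) ubc_space_scheme \<Rightarrow> (int \<times> 'a) rel \<Rightarrow> bool" where
  "uniformly_wide X V \<longleftrightarrow>
     uniform_scale X (\<lambda>n. slice V (int n)) \<and>
     (\<exists>U \<in> coarse X \<inter> uniform_ents X. \<forall>n\<le>0. slice V n = U)"

text \<open>\<open>V ^^ 0\<close> is the diagonal of the whole type rather than of the underlying set, but the
  inclusion below holds for \<open>l = 0\<close> with either reading.\<close>

definition adapted ::
    "('g, 'k) monoid_scheme \<Rightarrow> ('a, 'm) ubc_space_scheme \<Rightarrow> ('g \<Rightarrow> 'a \<Rightarrow> 'a) \<Rightarrow>
     (int \<times> 'a) rel \<Rightarrow> bool" where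
  "adapted G X \<alpha> V \<longleftrightarrow>
     sym V \<and> uniformly_wide X V \<and>
     (\<forall>g\<in>carrier G. \<exists>k::nat. \<forall>l::nat.
        translate (squeezing_action X \<alpha>) g (V ^^ l) \<subseteq> V ^^ (l * k))"


section \<open>Coarse quotients and branched coarse coverings\<close>

definition coarse_quotient ::
    "('g, 'k) monoid_scheme \<Rightarrow> ('g \<Rightarrow> 'a \<Rightarrow> 'a) \<Rightarrow> ('a, 'm) bc_space_scheme \<Rightarrow>
     ('a, 'm) bc_space_scheme" where
  "coarse_quotient G \<alpha> Y =
     Y\<lparr>coarse := coarse_generated (carrier Y)
        (coarse Y \<union> {{(\<alpha> g y, y) | y. y \<in> carrier Y} | g. g \<in> carrier G})\<rparr>"

definition semidirect_entourage ::
    "('g, 'k) monoid_scheme \<Rightarrow> ('g \<Rightarrow> 'a \<Rightarrow> 'a) \<Rightarrow> ('a, 'm) bc_space_scheme \<Rightarrow>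
     'a rel \<Rightarrow> ('g \<times> 'a) rel" where
  "semidirect_entourage G \<alpha> Y W =
     {((g, y), (g, y')) | g y y'. g \<in> carrier G \<and> y \<in> carrier Y \<and> y' \<in> carrier Y \<and>
        (\<alpha> (inv\<^bsub>G\<^esub> g) y, \<alpha> (inv\<^bsub>G\<^esub> g) y') \<in> W}"

definition semidirect ::
    "('g, 'k) monoid_scheme \<Rightarrow> ('g \<Rightarrow> 'a \<Rightarrow> 'a) \<Rightarrow> ('a, 'm) bc_space_scheme \<Rightarrow>
     ('g \<times> 'a) bc_space" where
  "semidirect G \<alpha> Y =
     \<lparr>carrier = carrier G \<times> carrier Y,
      bornology = bornology_generated (carrier G \<times> carrier Y)
        {F \<times> B | F B. F \<subseteq> carrier G \<and> finite F \<and> B \<in> bornology Y},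
      coarse = coarse_generated (carrier G \<times> carrier Y)
        {semidirect_entourage G \<alpha> Y W | W. W \<in> coarse Y}\<rparr>"

definition diagonal_action ::
    "('g, 'k) monoid_scheme \<Rightarrow> ('g \<Rightarrow> 'a \<Rightarrow> 'a) \<Rightarrow> ('a, 'm) bc_space_scheme \<Rightarrow>
     'g \<Rightarrow> 'g \<times> 'a \<Rightarrow> 'g \<times> 'a" where
  "diagonal_action G \<alpha> Y h = (\<lambda>(g, y)\<in>carrier G \<times> carrier Y. (h \<otimes>\<^bsub>G\<^esub> g, \<alpha> h y))"

text \<open>Right multiplication as a left action: \<open>h\<close> acts by \<open>g \<mapsto> g h\<^sup>-\<^sup>1\<close>, so that
  \<open>(g, y) \<mapsto> g\<^sup>-\<^sup>1 y\<close> intertwines it with the action on \<open>Y\<close>.\<close>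

definition right_action ::
    "('g, 'k) monoid_scheme \<Rightarrow> ('a, 'm) bc_space_scheme \<Rightarrow> 'g \<Rightarrow> 'g \<times> 'a \<Rightarrow> 'g \<times> 'a" where
  "right_action G Y h = (\<lambda>(g, y)\<in>carrier G \<times> carrier Y. (g \<otimes>\<^bsub>G\<^esub> inv\<^bsub>G\<^esub> h, y))"

definition fibre :: "('a, 'm) bc_space_scheme \<Rightarrow> ('a \<Rightarrow> 'b) \<Rightarrow> 'b \<Rightarrow> 'a set" where
  "fibre A f b = {a \<in> carrier A. f a = b}"

text \<open>The base \<open>B\<close> carries the trivial action, so equivariance of \<open>f\<close> reads
  \<open>f (\<alpha> g a) = f a\<close>. The relation \<open>P\<close> is an invariant subset of \<open>A \<times> A\<close> that need not be a
  coarse entourage.\<close>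

definition branched_coarse_covering ::
    "('g, 'k) monoid_scheme \<Rightarrow> ('a, 'm) bc_space_scheme \<Rightarrow> ('g \<Rightarrow> 'a \<Rightarrow> 'a) \<Rightarrow>
     ('b, 'n) bc_space_scheme \<Rightarrow> ('i::order \<Rightarrow> 'b set) \<Rightarrow> ('a \<Rightarrow> 'b) \<Rightarrow> bool" where
  "branched_coarse_covering G A \<alpha> B Z f \<longleftrightarrow>
     G_bornological_coarse G A \<alpha> \<and> bornological_coarse B \<and> big_family B Z \<and>
     f \<in> carrier A \<rightarrow> carrier B \<and>
     (\<forall>g\<in>carrier G. \<forall>a\<in>carrier A. f (\<alpha> g a) = f a) \<and>
     controlled A B f \<and> bornological_map A B f \<and>
     (\<forall>b\<in>carrier B. \<forall>S\<in>bornology A. finite (fibre A f b \<inter> S)) \<and>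
     (\<exists>P \<subseteq> carrier A \<times> carrier A.
        invariant_rel G \<alpha> P \<and>
        (\<forall>V\<in>coarse B. \<exists>i.
           (\<forall>(b', b) \<in> V \<inter> (carrier B \<times> (carrier B - Z i)).
              \<forall>a\<in>fibre A f b. \<exists>!a'. a' \<in> fibre A f b' \<and> (a', a) \<in> P) \<and>
           P \<inter> map_prod f f -` (V \<inter> (carrier B \<times> (carrier B - Z i))) \<in> coarse A) \<and>
        (\<forall>U\<in>coarse A. \<exists>i.
           U \<inter> (carrier A \<times> (f -` (carrier B - Z i) \<inter> carrier A)) \<subseteq> P))"

end

theory Submission
  imports Defs
begin

text \<open>Coarse entourages of the quotient \<open>Y//G\<close> are contained in finite unions of translates of coarse
  entourages of \<open>Y\<close>, and likewise upstairs, where a translate moves between the sheets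
  \<open>{g} \<times> Y\<close>. Lifting a pair \<open>(h c', c)\<close> with \<open>(c', c) \<in> V\<^sup>i\<close> to the total space means choosing
  \<open>h\<close>, and two choices \<open>h \<noteq> k\<close> would put a point and its translate by \<open>h\<inverse>k\<close> at
  \<open>V\<^sup>2\<^sup>i\<close>-distance. Uniform freeness excludes this at all sufficiently high levels, because the
  powers of \<open>V\<close> become uniformly small there. As \<open>G\<close> is countable, it is exhausted by finite sets;
  letting the finite set and the exponent grow slowly with the level yields one relation \<open>P\<close> that works
  for all entourages simultaneously.\<close>

section \<open>Generated structures\<close>

text \<open>The relation \<open>P\<close> is fixed before the entourages that test it, and the tests
  pull in opposite directions: far out it must contain every coarse entourage, yet give unique
  lifts. The level beyond which uniform freeness excludes a second lift is found for one finite set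
  of group elements and one power of \<open>V\<close> at a time. A relation made from a single such
  choice is in general too small, and the union over all choices can lose uniqueness. The way out is
  to admit at a level exactly those indices for which uniqueness already holds there; the slow
  growth is then built into a definition instead of being given by a function.

  Invariance of \<open>P\<close> is a second issue, since \<open>G\<close> only carries powers of
  \<open>V\<close> into other powers. A pair of points \<open>(g, y)\<close>,
  \<open>(g', y')\<close> of the total space is recorded by \<open>inv g \<otimes> g'\<close> and by
  \<open>y\<close>, \<open>y'\<close> carried back along \<open>inv g'\<close>. The diagonal action
  leaves these data unchanged, so any condition on them defines an invariant relation. The same
  device yields invariant entourages of the total space, although none are assumed for the action on
  the base.\<close>

lemma coarse_structure_onI:
  assumes "\<And>U. U \<in> \<C> \<Longrightarrow> U \<subseteq> X \<times> X" "Id_on X \<in> \<C>"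
    and "\<And>U U'. U \<in> \<C> \<Longrightarrow> U' \<subseteq> U \<Longrightarrow> U' \<in> \<C>"
    and "\<And>U U'. U \<in> \<C> \<Longrightarrow> U' \<in> \<C> \<Longrightarrow> U \<union> U' \<in> \<C>"
    and "\<And>U. U \<in> \<C> \<Longrightarrow> U\<inverse> \<in> \<C>"
    and "\<And>U U'. U \<in> \<C> \<Longrightarrow> U' \<in> \<C> \<Longrightarrow> U O U' \<in> \<C>"
  shows "coarse_structure_on X \<C>"
proof -
  have "\<C> \<subseteq> Pow (X \<times> X)" by (rule subsetI, rule PowI, rule assms(1))
  then show ?thesis unfolding coarse_structure_on_def
    by (intro conjI ballI allI impI)
      (assumption, rule assms(2), (rule assms(3-6); assumption)+)
qed

lemma coarse_structure_onD:
  assumes "coarse_structure_on X \<C>"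
  shows "U \<in> \<C> \<Longrightarrow> U \<subseteq> X \<times> X" "Id_on X \<in> \<C>"
    "U \<in> \<C> \<Longrightarrow> U' \<subseteq> U \<Longrightarrow> U' \<in> \<C>"
    "U \<in> \<C> \<Longrightarrow> U' \<in> \<C> \<Longrightarrow> U \<union> U' \<in> \<C>"
    "U \<in> \<C> \<Longrightarrow> U\<inverse> \<in> \<C>"
    "U \<in> \<C> \<Longrightarrow> U' \<in> \<C> \<Longrightarrow> U O U' \<in> \<C>"
proof -
  have "\<C> \<subseteq> Pow (X \<times> X)" "Id_on X \<in> \<C>"
    "\<forall>U\<in>\<C>. \<forall>U'. U' \<subseteq> U \<longrightarrow> U' \<in> \<C>" "\<forall>U\<in>\<C>. \<forall>U'\<in>\<C>. U \<union> U' \<in> \<C>"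
    "\<forall>U\<in>\<C>. U\<inverse> \<in> \<C>" "\<forall>U\<in>\<C>. \<forall>U'\<in>\<C>. U O U' \<in> \<C>"
    using assms unfolding coarse_structure_on_def by simp_all
  note \<C> = this
  from \<C>(1) show "U \<in> \<C> \<Longrightarrow> U \<subseteq> X \<times> X" by blast
  from \<C>(2-6) show "Id_on X \<in> \<C>"
    "U \<in> \<C> \<Longrightarrow> U' \<subseteq> U \<Longrightarrow> U' \<in> \<C>"
    "U \<in> \<C> \<Longrightarrow> U' \<in> \<C> \<Longrightarrow> U \<union> U' \<in> \<C>"
    "U \<in> \<C> \<Longrightarrow> U\<inverse> \<in> \<C>"
    "U \<in> \<C> \<Longrightarrow> U' \<in> \<C> \<Longrightarrow> U O U' \<in> \<C>"
    by simp_all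
qed

lemma coarse_structure_empty:
  assumes "coarse_structure_on X \<C>" shows "{} \<in> \<C>"
  by (rule coarse_structure_onD(3)[OF assms coarse_structure_onD(2)[OF assms] empty_subsetI])

lemma coarse_structure_UN:
  assumes "coarse_structure_on X \<C>" "finite I" "\<And>i. i \<in> I \<Longrightarrow> U i \<in> \<C>"
  shows "(\<Union>i\<in>I. U i) \<in> \<C>"
  using assms(2,3)
proof (induction I rule: finite_induct)
  case empty
  show ?case using coarse_structure_empty[OF assms(1)] by simp
next
  case (insert i I)
  then have "U i \<in> \<C>" "(\<Union>i\<in>I. U i) \<in> \<C>" by simp_all
  then have "U i \<union> (\<Union>i\<in>I. U i) \<in> \<C>" by (rule coarse_structure_onD(4)[OF assms(1)])
  then show ?case by simp
qed

text \<open>An intersection of coarse structures is one as soon as the family is nonempty. The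
  hypothesis supplies the member \<open>Pow (X \<times> X)\<close>; if it fails, the hull is the
  intersection of the empty family, that is, everything.\<close>

lemma coarse_structure_on_generated:
  assumes "\<S> \<subseteq> Pow (X \<times> X)"
  shows "coarse_structure_on X (coarse_generated X \<S>)"
proof -
  have "coarse_structure_on X (Pow (X \<times> X))"
    by (rule coarse_structure_onI) auto
  then have "coarse_generated X \<S> \<subseteq> Pow (X \<times> X)"
    using assms by (rule hull_minimal[rotated])
  then have bound: "U \<subseteq> X \<times> X" if "U \<in> coarse_generated X \<S>" for U
    using that by blast
  have I: "U \<in> coarse_generated X \<S>"
    if "\<And>\<C>. coarse_structure_on X \<C> \<Longrightarrow> \<S> \<subseteq> \<C> \<Longrightarrow> U \<in> \<C>" for U
    unfolding hull_def by (rule InterI, rule that) simp_all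
  have E: "U \<in> \<C>"
    if "U \<in> coarse_generated X \<S>" "coarse_structure_on X \<C>" "\<S> \<subseteq> \<C>" for U \<C>
    using that unfolding hull_def by (elim InterD) simp
  show ?thesis
  proof (rule coarse_structure_onI)
    show "Id_on X \<in> coarse_generated X \<S>" by (rule I, rule coarse_structure_onD(2))
  next
    fix U U' assume U: "U \<in> coarse_generated X \<S>"
    show "U \<subseteq> X \<times> X" using U by (rule bound)
    show "U\<inverse> \<in> coarse_generated X \<S>"
      by (rule I, rule coarse_structure_onD(5), assumption, rule E[OF U])
    show "U' \<in> coarse_generated X \<S>" if "U' \<subseteq> U"
      by (rule I, rule coarse_structure_onD(3), assumption, rule E[OF U], assumption+, rule that)
    assume U': "U' \<in> coarse_generated X \<S>"
    show "U \<union> U' \<in> coarse_generated X \<S>"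
      by (rule I, rule coarse_structure_onD(4), assumption, rule E[OF U], assumption+, rule E[OF U'])
    show "U O U' \<in> coarse_generated X \<S>"
      by (rule I, rule coarse_structure_onD(6), assumption, rule E[OF U], assumption+, rule E[OF U'])
  qed
qed

lemma bornology_onI:
  assumes "\<And>B. B \<in> \<B> \<Longrightarrow> B \<subseteq> X" "{} \<in> \<B>" "\<And>x. x \<in> X \<Longrightarrow> \<exists>B\<in>\<B>. x \<in> B"
    and "\<And>B B'. B \<in> \<B> \<Longrightarrow> B' \<subseteq> B \<Longrightarrow> B' \<in> \<B>"
    and "\<And>B B'. B \<in> \<B> \<Longrightarrow> B' \<in> \<B> \<Longrightarrow> B \<union> B' \<in> \<B>"
  shows "bornology_on X \<B>"
proof -
  have "\<B> \<subseteq> Pow X" by (rule subsetI, rule PowI, rule assms(1))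
  moreover have "X \<subseteq> \<Union>\<B>"
  proof
    fix x assume "x \<in> X"
    then obtain B where "B \<in> \<B>" "x \<in> B" using assms(3)[of x] by blast
    then show "x \<in> \<Union>\<B>" by blast
  qed
  ultimately have "\<B> \<subseteq> Pow X" "\<Union>\<B> = X" by blast+
  then show ?thesis unfolding bornology_on_def
    by (intro conjI ballI allI impI)
      (assumption, rule assms(2), assumption, (rule assms(4,5); assumption)+)
qed

lemma bornology_onD:
  assumes "bornology_on X \<B>"
  shows "B \<in> \<B> \<Longrightarrow> B \<subseteq> X" "{} \<in> \<B>" "x \<in> X \<Longrightarrow> \<exists>B\<in>\<B>. x \<in> B"
    "B \<in> \<B> \<Longrightarrow> B' \<subseteq> B \<Longrightarrow> B' \<in> \<B>"
    "B \<in> \<B> \<Longrightarrow> B' \<in> \<B> \<Longrightarrow> B \<union> B' \<in> \<B>"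
proof -
  have "\<B> \<subseteq> Pow X" "{} \<in> \<B>" "\<Union>\<B> = X"
    "\<forall>B\<in>\<B>. \<forall>B'. B' \<subseteq> B \<longrightarrow> B' \<in> \<B>" "\<forall>B\<in>\<B>. \<forall>B'\<in>\<B>. B \<union> B' \<in> \<B>"
    using assms unfolding bornology_on_def by simp_all
  note \<B> = this
  from \<B>(1) show "B \<in> \<B> \<Longrightarrow> B \<subseteq> X" by blast
  from \<B>(3) show "x \<in> X \<Longrightarrow> \<exists>B\<in>\<B>. x \<in> B" by blast
  from \<B>(2,4,5) show "{} \<in> \<B>"
    "B \<in> \<B> \<Longrightarrow> B' \<subseteq> B \<Longrightarrow> B' \<in> \<B>"
    "B \<in> \<B> \<Longrightarrow> B' \<in> \<B> \<Longrightarrow> B \<union> B' \<in> \<B>"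
    by simp_all
qed

lemma bornology_UN:
  assumes "bornology_on X \<B>" "finite I" "\<And>i. i \<in> I \<Longrightarrow> U i \<in> \<B>"
  shows "(\<Union>i\<in>I. U i) \<in> \<B>"
  using assms(2,3)
proof (induction I rule: finite_induct)
  case empty
  show ?case using bornology_onD(2)[OF assms(1)] by simp
next
  case (insert i I)
  then have "U i \<in> \<B>" "(\<Union>i\<in>I. U i) \<in> \<B>" by simp_all
  then have "U i \<union> (\<Union>i\<in>I. U i) \<in> \<B>" by (rule bornology_onD(5)[OF assms(1)])
  then show ?case by simp
qed

lemma bornology_on_boxes:
  assumes "bornology_on X \<B>"
  shows "bornology_on (I \<times> X) {T. \<exists>F B. F \<subseteq> I \<and> finite F \<and> B \<in> \<B> \<and> T \<subseteq> F \<times> B}"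
    (is "bornology_on _ ?R")
proof (rule bornology_onI)
  fix T T' assume "T \<in> ?R" "T' \<in> ?R"
  then obtain F B F' B' where "F \<subseteq> I" "finite F" "B \<in> \<B>" "T \<subseteq> F \<times> B"
    "F' \<subseteq> I" "finite F'" "B' \<in> \<B>" "T' \<subseteq> F' \<times> B'" by blast
  then have "F \<union> F' \<subseteq> I \<and> finite (F \<union> F') \<and> B \<union> B' \<in> \<B> \<and> T \<union> T' \<subseteq> (F \<union> F') \<times> (B \<union> B')"
    using bornology_onD(5)[OF assms] by auto
  then show "T \<union> T' \<in> ?R" by blast
next
  fix x assume "x \<in> I \<times> X"
  then obtain B where "B \<in> \<B>" "snd x \<in> B" "fst x \<in> I" using bornology_onD(3)[OF assms] by force
  then have "{fst x} \<times> B \<in> ?R" "x \<in> {fst x} \<times> B" by (auto simp: mem_Times_iff)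
  then show "\<exists>T\<in>?R. x \<in> T" by blast
next
  fix B assume "B \<in> ?R"
  then obtain F B' where "F \<subseteq> I" "B' \<in> \<B>" "B \<subseteq> F \<times> B'" by blast
  then show "B \<subseteq> I \<times> X" using bornology_onD(1)[OF assms, of B'] by blast
next
  show "{} \<in> ?R" using bornology_onD(2)[OF assms] by auto
next
  fix T T' assume "T \<in> ?R" and sub: "T' \<subseteq> T"
  then obtain F B where T: "F \<subseteq> I" "finite F" "B \<in> \<B>" "T \<subseteq> F \<times> B" by blast
  from sub T(4) have "T' \<subseteq> F \<times> B" by (rule subset_trans)
  with T(1-3) show "T' \<in> ?R" by (intro CollectI exI conjI)
qed

text \<open>Serves the squeezing space with \<open>I\<close> all integers and the total space with
  \<open>I = carrier G\<close>. A union of two boxes only lies inside a box, hence the subsets of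
  boxes on the right.\<close>

lemma bornology_generated_boxes:
  assumes "bornology_on X \<B>"
  shows "bornology_generated (I \<times> X) {F \<times> B | F B. F \<subseteq> I \<and> finite F \<and> B \<in> \<B>} =
    {T. \<exists>F B. F \<subseteq> I \<and> finite F \<and> B \<in> \<B> \<and> T \<subseteq> F \<times> B}" (is "?L = ?R")
proof (rule hull_unique)
  show "bornology_on (I \<times> X) ?R" by (rule bornology_on_boxes[OF assms])
next
  fix t' assume sub: "{F \<times> B | F B. F \<subseteq> I \<and> finite F \<and> B \<in> \<B>} \<subseteq> t'" and t': "bornology_on (I \<times> X) t'"
  show "?R \<subseteq> t'"
  proof
    fix T assume "T \<in> ?R"
    then obtain F B where T: "F \<subseteq> I" "finite F" "B \<in> \<B>" "T \<subseteq> F \<times> B" by blast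
    from T(1-3) have "F \<times> B \<in> {F \<times> B | F B. F \<subseteq> I \<and> finite F \<and> B \<in> \<B>}" by blast
    then have "F \<times> B \<in> t'" by (rule subsetD[OF sub])
    then show "T \<in> t'" using T(4) by (rule bornology_onD(4)[OF t'])
  qed
next
  show "{F \<times> B | F B. F \<subseteq> I \<and> finite F \<and> B \<in> \<B>} \<subseteq> ?R"
    by blast
qed

text \<open>Compatibility with a bornology is itself closed under all operations of a coarse
  structure, so by minimality of the hull it can be tested on generators. The clause for
  \<open>U\<inverse>\<close> is built in because boundedness of thickenings does not pass to the
  inverse by itself.\<close>

lemma coarse_structure_on_bounded_thickenings:
  assumes "bornology_on X \<B>"
  shows "coarse_structure_on X
    {U. U \<subseteq> X \<times> X \<and> (\<forall>B\<in>\<B>. thickening U B \<in> \<B> \<and> thickening (U\<inverse>) B \<in> \<B>)}"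
    (is "coarse_structure_on X ?C")
proof (rule coarse_structure_onI)
  have "thickening (Id_on X) B \<subseteq> B" for B
    unfolding thickening_def by auto
  then have "thickening (Id_on X) B \<in> \<B>" if "B \<in> \<B>" for B
    using bornology_onD(4)[OF assms that] by simp
  then show "Id_on X \<in> ?C"
    by auto
next
  fix U U' assume U: "U \<in> ?C"
  { assume sub: "U' \<subseteq> U"
    then have "thickening U' B \<subseteq> thickening U B" "thickening (U'\<inverse>) B \<subseteq> thickening (U\<inverse>) B" for B
      unfolding thickening_def by auto
    then have "thickening U' B \<in> \<B> \<and> thickening (U'\<inverse>) B \<in> \<B>" if "B \<in> \<B>" for B
      using U that bornology_onD(4)[OF assms, of "thickening U B" "thickening U' B"]
        bornology_onD(4)[OF assms, of "thickening (U\<inverse>) B" "thickening (U'\<inverse>) B"] by simp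
    with U sub show "U' \<in> ?C" by blast }
  assume U': "U' \<in> ?C"
  have "thickening (U \<union> U') B = thickening U B \<union> thickening U' B"
    "thickening ((U \<union> U')\<inverse>) B = thickening (U\<inverse>) B \<union> thickening (U'\<inverse>) B" for B
    unfolding thickening_def by auto
  then have "thickening (U \<union> U') B \<in> \<B> \<and> thickening ((U \<union> U')\<inverse>) B \<in> \<B>" if "B \<in> \<B>" for B
    using U U' that bornology_onD(5)[OF assms, of "thickening U B" "thickening U' B"]
      bornology_onD(5)[OF assms, of "thickening (U\<inverse>) B" "thickening (U'\<inverse>) B"] by simp
  with U U' show "U \<union> U' \<in> ?C"
    by simp
  have "thickening (U O U') B = thickening U (thickening U' B)"
    "thickening ((U O U')\<inverse>) B = thickening (U'\<inverse>) (thickening (U\<inverse>) B)" for B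
    unfolding thickening_def by blast+
  with U U' show "U O U' \<in> ?C"
    by auto
qed auto

lemma bornological_coarse_generated:
  fixes X :: "('a, 'm) bc_space_scheme"
  assumes bor: "bornology_on (carrier X) (bornology X)"
    and coarse: "coarse X = coarse_generated (carrier X) \<S>"
    and sub: "\<And>U. U \<in> \<S> \<Longrightarrow> U \<subseteq> carrier X \<times> carrier X"
    and bounded: "\<And>U B. U \<in> \<S> \<Longrightarrow> B \<in> bornology X \<Longrightarrow> thickening U B \<in> bornology X"
      "\<And>U B. U \<in> \<S> \<Longrightarrow> B \<in> bornology X \<Longrightarrow> thickening (U\<inverse>) B \<in> bornology X"
  shows "bornological_coarse X"
proof -
  have "coarse X \<subseteq> {U. U \<subseteq> carrier X \<times> carrier X \<and>
      (\<forall>B\<in>bornology X. thickening U B \<in> bornology X \<and> thickening (U\<inverse>) B \<in> bornology X)}"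
    unfolding coarse using sub bounded
    by (intro hull_minimal coarse_structure_on_bounded_thickenings[OF bor]) blast
  moreover have "coarse_structure_on (carrier X) (coarse X)"
    unfolding coarse using sub by (intro coarse_structure_on_generated) blast
  ultimately show ?thesis using bor unfolding bornological_coarse_def by blast
qed

lemma bornological_coarseD:
  assumes "bornological_coarse X"
  shows "bornology_on (carrier X) (bornology X)" "coarse_structure_on (carrier X) (coarse X)"
    "U \<in> coarse X \<Longrightarrow> B \<in> bornology X \<Longrightarrow> thickening U B \<in> bornology X"
  using assms unfolding bornological_coarse_def by auto

lemma in_map_prod_image:
  "(a, b) \<in> map_prod f g ` U \<longleftrightarrow> (\<exists>x y. (x, y) \<in> U \<and> a = f x \<and> b = g y)"
  by force

text \<open>The relations with coarse image form a coarse structure on the source, so the generators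
  decide. For a composition the image is only contained in the composite of the images, since
  \<open>f\<close> may identify different middle points; closure under subsets absorbs this.\<close>

lemma controlled_generated:
  assumes dom: "coarse X = coarse_generated (carrier X) \<S>"
    and f: "f \<in> carrier X \<rightarrow> carrier Y" and Y: "coarse_structure_on (carrier Y) (coarse Y)"
    and gen: "\<And>U. U \<in> \<S> \<Longrightarrow> U \<subseteq> carrier X \<times> carrier X"
      "\<And>U. U \<in> \<S> \<Longrightarrow> map_prod f f ` U \<in> coarse Y"
  shows "controlled X Y f"
proof -
  let ?C = "{U. U \<subseteq> carrier X \<times> carrier X \<and> map_prod f f ` U \<in> coarse Y}"
  have "coarse_structure_on (carrier X) ?C"
  proof (rule coarse_structure_onI)
    have "map_prod f f ` Id_on (carrier X) \<subseteq> Id_on (carrier Y)" using f by auto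
    then show "Id_on (carrier X) \<in> ?C"
      by (auto intro: coarse_structure_onD(3)[OF Y coarse_structure_onD(2)[OF Y]])
  next
    fix U assume U: "U \<in> ?C"
    have "map_prod f f ` (U\<inverse>) = (map_prod f f ` U)\<inverse>"
      by (auto simp: set_eq_iff in_map_prod_image)
    with U show "U\<inverse> \<in> ?C"
      using coarse_structure_onD(5)[OF Y, of "map_prod f f ` U"] by auto
    fix U'
    { assume sub: "U' \<subseteq> U"
      then have "map_prod f f ` U' \<subseteq> map_prod f f ` U" by (rule image_mono)
      with U sub coarse_structure_onD(3)[OF Y, of "map_prod f f ` U" "map_prod f f ` U'"]
      show "U' \<in> ?C" by blast }
    assume U': "U' \<in> ?C"
    then show "U \<union> U' \<in> ?C"
      using U coarse_structure_onD(4)[OF Y, of "map_prod f f ` U" "map_prod f f ` U'"]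
      unfolding mem_Collect_eq image_Un by blast
    have "map_prod f f ` (U O U') \<subseteq> (map_prod f f ` U) O (map_prod f f ` U')"
      by (rule subrelI) (unfold relcomp.simps in_map_prod_image, blast)
    then have "map_prod f f ` (U O U') \<in> coarse Y"
      using U U' coarse_structure_onD(3)[OF Y coarse_structure_onD(6)[OF Y,
        of "map_prod f f ` U" "map_prod f f ` U'"]] by blast
    with U U' show "U O U' \<in> ?C" by blast
  qed auto
  then have "coarse X \<subseteq> ?C" unfolding dom using gen by (intro hull_minimal) blast+
  then show ?thesis unfolding controlled_def by auto
qed

section \<open>Coarse quotients of a space with group action\<close>

text \<open>The total space is generated in two stages, by \<open>semidirect\<close> and then by
  \<open>coarse_quotient\<close>. Merging them gives one list of generators for all arguments by
  minimality.\<close>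

lemma coarse_generated_Un_generated:
  "coarse_generated X (coarse_generated X \<S> \<union> \<T>) = coarse_generated X (\<S> \<union> \<T>)"
proof -
  have "{t. coarse_structure_on X t \<and> coarse_generated X \<S> \<union> \<T> \<subseteq> t} =
      {t. coarse_structure_on X t \<and> \<S> \<union> \<T> \<subseteq> t}"
    by (intro Collect_cong conj_cong refl) (simp add: subset_hull)
  then show ?thesis unfolding hull_def[of _ "coarse_generated X \<S> \<union> \<T>"] hull_def[of _ "\<S> \<union> \<T>"]
    by simp
qed

text \<open>Images, not preimages, of bounded sets are assumed bounded: properness and control of
  \<open>\<psi> g\<close> and its inverse follow, because the inverse is
  \<open>\<psi> (inv g)\<close>. Invariant entourages are not assumed. The locale is used for the
  squeezing space and again for the total space with the diagonal action.\<close>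

locale bc_action = group_action G "carrier Y" \<psi>
  for G (structure) and Y :: "('y, 'n) bc_space_scheme" and \<psi> +
  assumes bornological_coarse: "bornological_coarse Y"
    and controlled_action: "g \<in> carrier G \<Longrightarrow> controlled Y Y (\<psi> g)"
    and bornological_action: "g \<in> carrier G \<Longrightarrow> bornological_map Y Y (\<psi> g)"
begin

sublocale group G
  using group_hom group_hom.axioms(1) by blast

abbreviation (input) "base \<equiv> coarse_quotient G \<psi> Y"
abbreviation (input) "cover \<equiv> coarse_quotient G (right_action G Y) (semidirect G \<psi> Y)"
abbreviation (input) "deck \<equiv> diagonal_action G \<psi> Y"

lemmas bornology_Y = bornological_coarseD(1)[OF bornological_coarse]
lemmas coarse_Y = bornological_coarseD(2)[OF bornological_coarse]

lemma act_closed [simp]: "g \<in> carrier G \<Longrightarrow> y \<in> carrier Y \<Longrightarrow> \<psi> g y \<in> carrier Y"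
  using element_image by blast

lemma act_one [simp]: "y \<in> carrier Y \<Longrightarrow> \<psi> \<one> y = y"
  using id_eq_one by (metis restrict_apply')

lemma act_mult:
  "g \<in> carrier G \<Longrightarrow> h \<in> carrier G \<Longrightarrow> y \<in> carrier Y \<Longrightarrow> \<psi> g (\<psi> h y) = \<psi> (g \<otimes> h) y"
  using composition_rule by simp

lemma act_inv [simp]:
  assumes "g \<in> carrier G" "y \<in> carrier Y"
  shows "\<psi> (inv g) (\<psi> g y) = y" "\<psi> g (\<psi> (inv g) y) = y"
  using assms by (simp_all add: act_mult)

lemma translate_coarse:
  "g \<in> carrier G \<Longrightarrow> W \<in> coarse Y \<Longrightarrow> translate \<psi> g W \<in> coarse Y"
  using controlled_action unfolding controlled_def translate_def by blast

lemma translateI: "(a, b) \<in> W \<Longrightarrow> (\<psi> g a, \<psi> g b) \<in> translate \<psi> g W"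
  unfolding translate_def in_map_prod_image by blast

lemma image_bounded: "g \<in> carrier G \<Longrightarrow> B \<in> bornology Y \<Longrightarrow> \<psi> g ` B \<in> bornology Y"
  using bornological_action unfolding bornological_map_def by blast

lemma coarse_carrier: "W \<in> coarse Y \<Longrightarrow> (a, b) \<in> W \<Longrightarrow> a \<in> carrier Y \<and> b \<in> carrier Y"
  using coarse_structure_onD(1)[OF coarse_Y, of W] by blast

lemma UN_translate_coarse:
  assumes "finite F" "F \<subseteq> carrier G" "W \<in> coarse Y"
  shows "(\<Union>h\<in>F. translate \<psi> h W) \<in> coarse Y" "(\<Union>h\<in>F. translate \<psi> (inv h) W) \<in> coarse Y"
  using assms by (auto intro!: coarse_structure_UN[OF coarse_Y] translate_coarse)

subsection \<open>The base\<close>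

text \<open>A normal form for composites of generators of the quotient: one group element in front
  of one entourage. A group element moves past an entourage at the price of translating it, and
  finitely many translates of a coarse entourage have a coarse union; this is why \<open>F\<close>
  is kept finite below.\<close>

definition base_rel :: "'a set \<Rightarrow> 'y rel \<Rightarrow> 'y rel" where
  "base_rel F W = {(\<psi> h y', y) | h y' y. h \<in> F \<and> (y', y) \<in> W}"

lemma base_rel_subset:
  assumes "E \<in> coarse base"
  shows "\<exists>F W. finite F \<and> F \<subseteq> carrier G \<and> W \<in> coarse Y \<and> E \<subseteq> base_rel F W"
proof -
  let ?C = "{E. \<exists>F W. finite F \<and> F \<subseteq> carrier G \<and> W \<in> coarse Y \<and> E \<subseteq> base_rel F W}"
  have C: "E \<in> ?C" if "finite F" "F \<subseteq> carrier G" "W \<in> coarse Y" "E \<subseteq> base_rel F W" for E F W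
    using that by blast
  have "coarse_structure_on (carrier Y) ?C"
  proof (rule coarse_structure_onI)
    show "Id_on (carrier Y) \<in> ?C"
    proof (rule C)
      show "Id_on (carrier Y) \<subseteq> base_rel {\<one>} (Id_on (carrier Y))"
        unfolding base_rel_def by (force simp: Id_on_def)
    qed (auto intro: coarse_structure_onD(2)[OF coarse_Y])
  next
    fix E assume "E \<in> ?C"
    then obtain F W where E: "finite F" "F \<subseteq> carrier G" "W \<in> coarse Y" "E \<subseteq> base_rel F W" by blast
    show "E \<subseteq> carrier Y \<times> carrier Y"
    proof
      fix p assume "p \<in> E"
      then obtain h y' y where "p = (\<psi> h y', y)" "h \<in> F" "(y', y) \<in> W"
        using E(4) unfolding base_rel_def by blast
      then show "p \<in> carrier Y \<times> carrier Y" using coarse_carrier[OF E(3)] E(2) by auto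
    qed
    show "E' \<in> ?C" if "E' \<subseteq> E" for E'
      using E(1-3) subset_trans[OF that E(4)] by (rule C)
    show "E\<inverse> \<in> ?C"
    proof (rule C)
      show "finite ((\<lambda>h. inv h) ` F)" "(\<lambda>h. inv h) ` F \<subseteq> carrier G" using E(1,2) by auto
      show "(\<Union>h\<in>F. translate \<psi> h (W\<inverse>)) \<in> coarse Y"
        by (rule UN_translate_coarse(1)[OF E(1,2) coarse_structure_onD(5)[OF coarse_Y E(3)]])
      show "E\<inverse> \<subseteq> base_rel ((\<lambda>h. inv h) ` F) (\<Union>h\<in>F. translate \<psi> h (W\<inverse>))"
      proof
        fix p assume "p \<in> E\<inverse>"
        then obtain h y' y where p: "p = (y, \<psi> h y')" "h \<in> F" "(y', y) \<in> W"
          using E(4) unfolding base_rel_def by blast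
        then have "(\<psi> h y, \<psi> h y') \<in> (\<Union>h\<in>F. translate \<psi> h (W\<inverse>))"
          by (intro UN_I[of h] translateI) auto
        moreover have "p = (\<psi> (inv h) (\<psi> h y), \<psi> h y')"
          using p E(2) coarse_carrier[OF E(3) p(3)] by auto
        ultimately show "p \<in> base_rel ((\<lambda>h. inv h) ` F) (\<Union>h\<in>F. translate \<psi> h (W\<inverse>))"
          unfolding base_rel_def using p(2) by blast
      qed
    qed
    fix E' assume "E' \<in> ?C"
    then obtain F' W' where E': "finite F'" "F' \<subseteq> carrier G" "W' \<in> coarse Y" "E' \<subseteq> base_rel F' W'"
      by blast
    show "E \<union> E' \<in> ?C"
    proof (rule C)
      show "finite (F \<union> F')" "F \<union> F' \<subseteq> carrier G" using E E' by auto
      show "W \<union> W' \<in> coarse Y" by (rule coarse_structure_onD(4)[OF coarse_Y E(3) E'(3)])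
      show "E \<union> E' \<subseteq> base_rel (F \<union> F') (W \<union> W')"
        using E(4) E'(4) unfolding base_rel_def by blast
    qed
    show "E O E' \<in> ?C"
    proof (rule C)
      \<comment> \<open>The second group element \<open>h'\<close> is moved in front of the first
        entourage, which is thereby translated by \<open>inv h'\<close>.\<close>
      let ?F = "(\<lambda>(h, h'). h \<otimes> h') ` (F \<times> F')"
      let ?W = "(\<Union>h\<in>F'. translate \<psi> (inv h) W) O W'"
      show "finite ?F" "?F \<subseteq> carrier G" using E(1,2) E'(1,2) by auto
      show "?W \<in> coarse Y"
        by (rule coarse_structure_onD(6)[OF coarse_Y UN_translate_coarse(2)[OF E'(1,2) E(3)] E'(3)])
      show "E O E' \<subseteq> base_rel ?F ?W"
      proof
        fix p assume "p \<in> E O E'"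
        then obtain a b c where p: "p = (a, c)" "(a, b) \<in> base_rel F W" "(b, c) \<in> base_rel F' W'"
          using E(4) E'(4) by blast
        then obtain h y' h' z' where h: "h \<in> F" "(y', b) \<in> W" "a = \<psi> h y'"
          "h' \<in> F'" "(z', c) \<in> W'" "b = \<psi> h' z'"
          unfolding base_rel_def by blast
        have G: "h \<in> carrier G" "h' \<in> carrier G" using h E(2) E'(2) by auto
        have Y: "y' \<in> carrier Y" "b \<in> carrier Y" "z' \<in> carrier Y"
          using coarse_carrier[OF E(3) h(2)] coarse_carrier[OF E'(3) h(5)] by auto
        have "(\<psi> (inv h') y', \<psi> (inv h') b) \<in> (\<Union>h\<in>F'. translate \<psi> (inv h) W)"
          using h by (intro UN_I[of h'] translateI)
        moreover have "\<psi> (inv h') b = z'" using h G Y by simp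
        ultimately have "(\<psi> (inv h') y', c) \<in> ?W" using h by blast
        moreover have "a = \<psi> (h \<otimes> h') (\<psi> (inv h') y')"
          using h G Y by (simp flip: act_mult)
        ultimately show "p \<in> base_rel ?F ?W"
          unfolding base_rel_def p(1) using h(1,4) by blast
      qed
    qed
  qed
  moreover have "coarse Y \<union> {{(\<psi> g y, y) | y. y \<in> carrier Y} | g. g \<in> carrier G} \<subseteq> ?C"
  proof (intro Un_least subsetI)
    fix E assume E: "E \<in> coarse Y"
    show "E \<in> ?C"
    proof (rule C)
      show "E \<subseteq> base_rel {\<one>} E"
      proof
        fix p assume p: "p \<in> E"
        then have "\<psi> \<one> (fst p) = fst p" using coarse_carrier[OF E, of "fst p" "snd p"] by simp
        then show "p \<in> base_rel {\<one>} E" using p unfolding base_rel_def by (cases p) force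
      qed
    qed (use E in auto)
  next
    fix E assume "E \<in> {{(\<psi> g y, y) | y. y \<in> carrier Y} | g. g \<in> carrier G}"
    then obtain g where g: "g \<in> carrier G" "E = {(\<psi> g y, y) | y. y \<in> carrier Y}" by blast
    show "E \<in> ?C"
    proof (rule C)
      show "E \<subseteq> base_rel {g} (Id_on (carrier Y))" unfolding g(2) base_rel_def by blast
    qed (use g coarse_structure_onD(2)[OF coarse_Y] in auto)
  qed
  ultimately have "coarse base \<subseteq> ?C"
    unfolding coarse_quotient_def by (simp add: hull_minimal)
  with assms show ?thesis by blast
qed

lemma carrier_base [simp]: "carrier base = carrier Y" "bornology base = bornology Y"
  unfolding coarse_quotient_def by simp_all

lemma coarse_base: "coarse base = coarse_generated (carrier base)
    (coarse Y \<union> {{(\<psi> g y, y) | y. y \<in> carrier Y} | g. g \<in> carrier G})"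
  unfolding coarse_quotient_def by simp

lemma bornological_coarse_base: "bornological_coarse base"
proof (rule bornological_coarse_generated[OF _ coarse_base]; (unfold carrier_base)?)
  show "bornology_on (carrier Y) (bornology Y)" by (rule bornology_Y)
next
  fix U assume "U \<in> coarse Y \<union> {{(\<psi> g y, y) | y. y \<in> carrier Y} | g. g \<in> carrier G}"
  then consider "U \<in> coarse Y" | g where "g \<in> carrier G" "U = {(\<psi> g y, y) | y. y \<in> carrier Y}"
    by blast
  then have "U \<subseteq> carrier Y \<times> carrier Y \<and>
      (\<forall>B\<in>bornology Y. thickening U B \<in> bornology Y \<and> thickening (U\<inverse>) B \<in> bornology Y)"
  proof cases
    case 1
    then show ?thesis
      using bornological_coarseD(3)[OF bornological_coarse] coarse_structure_onD(1,5)[OF coarse_Y, of U]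
      by auto
  next
    case (2 g)
    have "thickening U B \<subseteq> \<psi> g ` B" "thickening (U\<inverse>) B \<subseteq> \<psi> (inv g) ` B" for B
      using 2 unfolding thickening_def by (auto simp: image_iff intro!: bexI[rotated])
    moreover have "U \<subseteq> carrier Y \<times> carrier Y" using 2 by auto
    ultimately show ?thesis
      using bornology_onD(4)[OF bornology_Y image_bounded] 2(1) by (meson inv_closed)
  qed
  then show "U \<subseteq> carrier Y \<times> carrier Y"
    "\<And>B. B \<in> bornology Y \<Longrightarrow> thickening U B \<in> bornology Y"
    "\<And>B. B \<in> bornology Y \<Longrightarrow> thickening (U\<inverse>) B \<in> bornology Y"
    by blast+
qed

subsection \<open>The total space\<close>

text \<open>Everything is read in the coordinates of the sheet of the second point. With
  \<open>h = inv g \<otimes> g'\<close>, \<open>c' = \<psi> (inv g') y\<close> and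
  \<open>c = \<psi> (inv g') y'\<close>, the second point lies over \<open>c\<close> and the first
  over \<open>\<psi> h c'\<close>. The triple \<open>h\<close>, \<open>c'\<close>, \<open>c\<close>
  determines the pair up to the diagonal action.\<close>

definition lift_rel :: "('a \<Rightarrow> 'y \<Rightarrow> 'y \<Rightarrow> bool) \<Rightarrow> ('a \<times> 'y) rel" where
  "lift_rel R = {((g, y), (g', y')) | g y g' y'.
     g \<in> carrier G \<and> y \<in> carrier Y \<and> g' \<in> carrier G \<and> y' \<in> carrier Y \<and>
     R (inv g \<otimes> g') (\<psi> (inv g') y) (\<psi> (inv g') y')}"

abbreviation cover_rel :: "'a set \<Rightarrow> 'y rel \<Rightarrow> ('a \<times> 'y) rel" where
  "cover_rel F W \<equiv> lift_rel (\<lambda>h y y'. h \<in> F \<and> (y, y') \<in> W)"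

lemma in_lift_rel: "((g, y), (g', y')) \<in> lift_rel R \<longleftrightarrow>
    g \<in> carrier G \<and> y \<in> carrier Y \<and> g' \<in> carrier G \<and> y' \<in> carrier Y \<and>
    R (inv g \<otimes> g') (\<psi> (inv g') y) (\<psi> (inv g') y')"
  unfolding lift_rel_def by blast

lemma lift_rel_subset: "lift_rel R \<subseteq> (carrier G \<times> carrier Y) \<times> (carrier G \<times> carrier Y)"
  unfolding lift_rel_def by blast

lemma lift_rel_mono:
  assumes "\<And>h y y'. R h y y' \<Longrightarrow> R' h y y'"
  shows "lift_rel R \<subseteq> lift_rel R'"
  using assms unfolding lift_rel_def by blast

lemma deck_apply [simp]:
  "g \<in> carrier G \<Longrightarrow> y \<in> carrier Y \<Longrightarrow> deck k (g, y) = (k \<otimes> g, \<psi> k y)"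
  unfolding diagonal_action_def by simp

lemma invariant_lift_rel: "invariant_rel G deck (lift_rel R)"
proof -
  have sub: "translate deck k (lift_rel R) \<subseteq> lift_rel R" if k: "k \<in> carrier G" for k
  proof
    fix p assume "p \<in> translate deck k (lift_rel R)"
    then obtain g y g' y' where p: "((g, y), (g', y')) \<in> lift_rel R"
      "p = (deck k (g, y), deck k (g', y'))"
      unfolding translate_def by auto
    then have c: "g \<in> carrier G" "y \<in> carrier Y" "g' \<in> carrier G" "y' \<in> carrier Y"
      by (simp_all add: in_lift_rel)
    have "inv (k \<otimes> g) \<otimes> (k \<otimes> g') = inv g \<otimes> g'"
      using c k by (simp add: inv_mult_group m_assoc inv_solve_left')
    moreover have "\<psi> (inv (k \<otimes> g')) (\<psi> k z) = \<psi> (inv g') z" if "z \<in> carrier Y" for z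
      using c k that by (simp add: inv_mult_group flip: act_mult)
    ultimately show "p \<in> lift_rel R" using p c k by (simp add: in_lift_rel)
  qed
  \<comment> \<open>The reverse inclusion is the inclusion for \<open>inv k\<close>, moved by
    \<open>k\<close>.\<close>
  have "lift_rel R \<subseteq> translate deck k (lift_rel R)" if k: "k \<in> carrier G" for k
  proof
    fix p assume p: "p \<in> lift_rel R"
    obtain g y g' y' where q: "p = ((g, y), (g', y'))" by (metis surj_pair)
    then have c: "g \<in> carrier G" "y \<in> carrier Y" "g' \<in> carrier G" "y' \<in> carrier Y"
      using p by (simp_all add: in_lift_rel)
    let ?a = "deck (inv k) (g, y)" and ?b = "deck (inv k) (g', y')"
    have "(?a, ?b) \<in> translate deck (inv k) (lift_rel R)"
      unfolding translate_def in_map_prod_image using p q by blast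
    then have "(?a, ?b) \<in> lift_rel R" using sub[of "inv k"] k by auto
    then have "(deck k ?a, deck k ?b) \<in> translate deck k (lift_rel R)"
      unfolding translate_def in_map_prod_image by blast
    then show "p \<in> translate deck k (lift_rel R)"
      using c k q by (simp flip: m_assoc)
  qed
  with sub show ?thesis unfolding invariant_rel_def by blast
qed

section \<open>Bornology and coarse structure of the total space\<close>

lemma carrier_cover [simp]: "carrier cover = carrier G \<times> carrier Y"
  unfolding coarse_quotient_def semidirect_def by simp

lemma bornology_cover: "bornology cover =
    {T. \<exists>F B. F \<subseteq> carrier G \<and> finite F \<and> B \<in> bornology Y \<and> T \<subseteq> F \<times> B}"
  unfolding coarse_quotient_def semidirect_def
  by (simp add: bornology_generated_boxes[OF bornology_Y])

lemma coarse_cover: "coarse cover = coarse_generated (carrier cover)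
    ({semidirect_entourage G \<psi> Y W | W. W \<in> coarse Y} \<union>
     {{(right_action G Y h a, a) | a. a \<in> carrier G \<times> carrier Y} | h. h \<in> carrier G})"
  unfolding coarse_quotient_def semidirect_def by (simp add: coarse_generated_Un_generated)

lemma cover_generator_cases:
  assumes "U \<in> {semidirect_entourage G \<psi> Y W | W. W \<in> coarse Y} \<union>
     {{(right_action G Y h a, a) | a. a \<in> carrier G \<times> carrier Y} | h. h \<in> carrier G}"
  obtains W where "W \<in> coarse Y"
      "U = {((g, y), (g, y')) | g y y'. g \<in> carrier G \<and> y \<in> carrier Y \<and> y' \<in> carrier Y \<and>
        (\<psi> (inv g) y, \<psi> (inv g) y') \<in> W}"
    | h where "h \<in> carrier G"
      "U = {((g \<otimes> inv h, y), (g, y)) | g y. g \<in> carrier G \<and> y \<in> carrier Y}"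
proof -
  from assms consider W where "W \<in> coarse Y" "U = semidirect_entourage G \<psi> Y W"
    | h where "h \<in> carrier G" "U = {(right_action G Y h a, a) | a. a \<in> carrier G \<times> carrier Y}"
    by blast
  then show thesis
  proof cases
    case 1
    then show thesis unfolding semidirect_entourage_def by (rule that(1))
  next
    case 2
    have "U = {((g \<otimes> inv h, y), (g, y)) | g y. g \<in> carrier G \<and> y \<in> carrier Y}"
      unfolding 2(2) right_action_def by auto
    with 2(1) show thesis by (rule that(2))
  qed
qed

lemma bornological_coarse_cover: "bornological_coarse cover"
proof (rule bornological_coarse_generated[OF _ coarse_cover])
  show born: "bornology_on (carrier cover) (bornology cover)"
    unfolding bornology_cover carrier_cover by (rule bornology_on_boxes[OF bornology_Y])
  fix U
  assume "U \<in> {semidirect_entourage G \<psi> Y W | W. W \<in> coarse Y} \<union>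
     {{(right_action G Y h a, a) | a. a \<in> carrier G \<times> carrier Y} | h. h \<in> carrier G}"
  then have "U \<subseteq> carrier cover \<times> carrier cover \<and>
      (\<forall>T\<in>bornology cover. thickening U T \<in> bornology cover \<and> thickening (U\<inverse>) T \<in> bornology cover)"
  proof (cases rule: cover_generator_cases)
    case (1 W)
    have bounded: "thickening {((g, y), (g, y')) | g y y'. g \<in> carrier G \<and> y \<in> carrier Y \<and>
        y' \<in> carrier Y \<and> (\<psi> (inv g) y, \<psi> (inv g) y') \<in> W} T \<in> bornology cover"
      (is "thickening ?U T \<in> _")
      if W: "W \<in> coarse Y" and T: "T \<in> bornology cover" for W T
    proof -
      obtain F B where F: "F \<subseteq> carrier G" "finite F" "B \<in> bornology Y" "T \<subseteq> F \<times> B"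
        using T unfolding bornology_cover by blast
      \<comment> \<open>A sheetwise entourage acts on the sheet of \<open>g\<close> as the
        \<open>g\<close>-translate of \<open>W\<close>. A single bounded set serves for all sheets
        because \<open>T\<close> meets only finitely many.\<close>
      let ?B = "\<Union>g\<in>F. \<psi> g ` thickening W (\<psi> (inv g) ` B)"
      have "?B \<in> bornology Y"
        using F by (intro bornology_UN[OF bornology_Y] image_bounded
          bornological_coarseD(3)[OF bornological_coarse W]) auto
      moreover have "thickening ?U T \<subseteq> F \<times> ?B"
      proof
        fix p assume "p \<in> thickening ?U T"
        then obtain g y y' where p: "p = (g, y)" "(g, y') \<in> T" "g \<in> carrier G" "y \<in> carrier Y"
          "(\<psi> (inv g) y, \<psi> (inv g) y') \<in> W"
          unfolding thickening_def by blast
        then have "g \<in> F" "y' \<in> B" using F(4) by auto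
        moreover from this p(5) have "\<psi> (inv g) y \<in> thickening W (\<psi> (inv g) ` B)"
          unfolding thickening_def by blast
        then have "\<psi> g (\<psi> (inv g) y) \<in> \<psi> g ` thickening W (\<psi> (inv g) ` B)" by (rule imageI)
        ultimately show "p \<in> F \<times> ?B" using p by auto
      qed
      ultimately show ?thesis unfolding bornology_cover using F(1,2) by blast
    qed
    have "U\<inverse> = {((g, y), (g, y')) | g y y'. g \<in> carrier G \<and> y \<in> carrier Y \<and>
        y' \<in> carrier Y \<and> (\<psi> (inv g) y, \<psi> (inv g) y') \<in> W\<inverse>}"
      unfolding 1(2) by auto
    then have "\<forall>T\<in>bornology cover. thickening U T \<in> bornology cover \<and>
        thickening (U\<inverse>) T \<in> bornology cover"
      using bounded[OF 1(1)] bounded[OF coarse_structure_onD(5)[OF coarse_Y 1(1)]]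
      unfolding 1(2) by simp
    moreover have "U \<subseteq> carrier cover \<times> carrier cover" unfolding 1(2) by auto
    ultimately show ?thesis by blast
  next
    case (2 h)
    have "thickening U T \<in> bornology cover \<and> thickening (U\<inverse>) T \<in> bornology cover"
      if T: "T \<in> bornology cover" for T
    proof -
      obtain F B where F: "F \<subseteq> carrier G" "finite F" "B \<in> bornology Y" "T \<subseteq> F \<times> B"
        using T unfolding bornology_cover by blast
      have "thickening U T \<subseteq> (\<lambda>g. g \<otimes> inv h) ` F \<times> B"
        using F(4) unfolding 2(2) thickening_def by auto
      moreover have "(\<lambda>g. g \<otimes> inv h) ` F \<subseteq> carrier G" "finite ((\<lambda>g. g \<otimes> inv h) ` F)"
        using F 2(1) by auto
      moreover have "thickening (U\<inverse>) T \<subseteq> (\<lambda>g. g \<otimes> h) ` F \<times> B"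
      proof
        fix p assume "p \<in> thickening (U\<inverse>) T"
        then obtain g y where p: "p = (g, y)" "g \<in> carrier G" "(g \<otimes> inv h, y) \<in> T"
          unfolding 2(2) thickening_def by blast
        then have "g = (g \<otimes> inv h) \<otimes> h" using 2(1) by (simp add: m_assoc)
        moreover have "g \<otimes> inv h \<in> F" "y \<in> B" using p(3) F(4) by auto
        ultimately show "p \<in> (\<lambda>g. g \<otimes> h) ` F \<times> B" unfolding p(1) by blast
      qed
      moreover have "(\<lambda>g. g \<otimes> h) ` F \<subseteq> carrier G" "finite ((\<lambda>g. g \<otimes> h) ` F)"
        using F 2(1) by auto
      ultimately show ?thesis unfolding bornology_cover using F(3) by blast
    qed
    moreover have "U \<subseteq> carrier cover \<times> carrier cover" using 2 by auto
    ultimately show ?thesis by blast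
  qed
  then show "U \<subseteq> carrier cover \<times> carrier cover"
    "\<And>T. T \<in> bornology cover \<Longrightarrow> thickening U T \<in> bornology cover"
    "\<And>T. T \<in> bornology cover \<Longrightarrow> thickening (U\<inverse>) T \<in> bornology cover"
    by blast+
qed

lemmas coarse_structure_cover = bornological_coarseD(2)[OF bornological_coarse_cover]

text \<open>Each pair factors through \<open>(g', y)\<close>: right translation by
  \<open>inv g \<otimes> g'\<close> changes the sheet and keeps \<open>y\<close>, and a move inside
  the sheet of \<open>g'\<close> does the rest.\<close>

lemma cover_rel_coarse:
  assumes F: "finite F" "F \<subseteq> carrier G" and W: "W \<in> coarse Y"
  shows "cover_rel F W \<in> coarse cover"
proof -
  let ?R = "\<lambda>h. {(right_action G Y h a, a) | a. a \<in> carrier G \<times> carrier Y}"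
  let ?W = "semidirect_entourage G \<psi> Y W"
  have W': "?W \<in> coarse cover"
    unfolding coarse_cover by (rule hull_inc) (use W in blast)
  have "?R h \<in> coarse cover" if "h \<in> F" for h
    unfolding coarse_cover by (rule hull_inc) (use that F(2) in blast)
  then have "(\<Union>h\<in>F. ?R h O ?W) \<in> coarse cover"
    using W' by (intro coarse_structure_UN[OF coarse_structure_cover F(1)]
      coarse_structure_onD(6)[OF coarse_structure_cover])
  moreover have "cover_rel F W \<subseteq> (\<Union>h\<in>F. ?R h O ?W)"
  proof
    fix p assume p: "p \<in> cover_rel F W"
    obtain g y g' y' where q: "p = ((g, y), (g', y'))" by (metis surj_pair)
    have c: "g \<in> carrier G" "y \<in> carrier Y" "g' \<in> carrier G" "y' \<in> carrier Y"
      "inv g \<otimes> g' \<in> F" "(\<psi> (inv g') y, \<psi> (inv g') y') \<in> W"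
      using p unfolding q in_lift_rel by auto
    have "g' \<otimes> inv (inv g \<otimes> g') = g"
      using c by (simp add: inv_mult_group flip: m_assoc)
    then have "right_action G Y (inv g \<otimes> g') (g', y) = (g, y)"
      using c unfolding right_action_def by simp
    then have "((g, y), (g', y)) \<in> ?R (inv g \<otimes> g')"
      using c by (metis (mono_tags, lifting) SigmaI mem_Collect_eq)
    moreover have "((g', y), (g', y')) \<in> ?W"
      using c unfolding semidirect_entourage_def by blast
    ultimately show "p \<in> (\<Union>h\<in>F. ?R h O ?W)" unfolding q using c(5) by blast
  qed
  ultimately show ?thesis by (rule coarse_structure_onD(3)[OF coarse_structure_cover])
qed

text \<open>The counterpart of \<open>base_rel_subset\<close>. Displacements are measured from the
  sheet of the second point, so inverting or composing changes the reference sheet; the entourage is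
  then translated by the shift between the two reference sheets, of which only finitely many
  occur.\<close>

lemma cover_rel_subset:
  assumes "E \<in> coarse cover"
  shows "\<exists>F W. finite F \<and> F \<subseteq> carrier G \<and> W \<in> coarse Y \<and> E \<subseteq> cover_rel F W"
proof -
  let ?C = "{E. \<exists>F W. finite F \<and> F \<subseteq> carrier G \<and> W \<in> coarse Y \<and> E \<subseteq> cover_rel F W}"
  have C: "E \<in> ?C" if "finite F" "F \<subseteq> carrier G" "W \<in> coarse Y" "E \<subseteq> cover_rel F W" for E F W
    using that by blast
  have "coarse_structure_on (carrier cover) ?C"
  proof (rule coarse_structure_onI)
    show "Id_on (carrier cover) \<in> ?C"
    proof (rule C)
      show "Id_on (carrier cover) \<subseteq> cover_rel {\<one>} (Id_on (carrier Y))"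
        by (auto simp: in_lift_rel)
    qed (auto intro: coarse_structure_onD(2)[OF coarse_Y])
  next
    fix E assume "E \<in> ?C"
    then obtain F W where E: "finite F" "F \<subseteq> carrier G" "W \<in> coarse Y" "E \<subseteq> cover_rel F W" by blast
    show "E \<subseteq> carrier cover \<times> carrier cover"
      using subset_trans[OF E(4) lift_rel_subset] by simp
    show "E' \<in> ?C" if "E' \<subseteq> E" for E'
      using E(1-3) subset_trans[OF that E(4)] by (rule C)
    show "E\<inverse> \<in> ?C"
    proof (rule C)
      show "finite ((\<lambda>h. inv h) ` F)" "(\<lambda>h. inv h) ` F \<subseteq> carrier G" using E(1,2) by auto
      show "(\<Union>h\<in>F. translate \<psi> h (W\<inverse>)) \<in> coarse Y"
        by (rule UN_translate_coarse(1)[OF E(1,2) coarse_structure_onD(5)[OF coarse_Y E(3)]])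
      show "E\<inverse> \<subseteq> cover_rel ((\<lambda>h. inv h) ` F) (\<Union>h\<in>F. translate \<psi> h (W\<inverse>))"
      proof
        fix p assume p: "p \<in> E\<inverse>"
        obtain g y g' y' where q: "p = ((g', y'), (g, y))" by (metis surj_pair)
        have "((g, y), (g', y')) \<in> cover_rel F W" using p q E(4) by blast
        then have c: "g \<in> carrier G" "y \<in> carrier Y" "g' \<in> carrier G" "y' \<in> carrier Y"
          "inv g \<otimes> g' \<in> F" "(\<psi> (inv g') y, \<psi> (inv g') y') \<in> W"
          unfolding in_lift_rel by auto
        have "(\<psi> (inv g \<otimes> g') (\<psi> (inv g') y'), \<psi> (inv g \<otimes> g') (\<psi> (inv g') y))
            \<in> (\<Union>h\<in>F. translate \<psi> h (W\<inverse>))"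
          using c by (intro UN_I[of "inv g \<otimes> g'"] translateI) auto
        moreover have "\<psi> (inv g \<otimes> g') (\<psi> (inv g') z) = \<psi> (inv g) z" if "z \<in> carrier Y" for z
          using c that by (simp flip: act_mult)
        ultimately have "(\<psi> (inv g) y', \<psi> (inv g) y) \<in> (\<Union>h\<in>F. translate \<psi> h (W\<inverse>))"
          using c by simp
        moreover have "inv g' \<otimes> g = inv (inv g \<otimes> g')"
          using c by (simp add: inv_mult_group)
        then have "inv g' \<otimes> g \<in> (\<lambda>h. inv h) ` F" using c by blast
        ultimately show "p \<in> cover_rel ((\<lambda>h. inv h) ` F) (\<Union>h\<in>F. translate \<psi> h (W\<inverse>))"
          unfolding q in_lift_rel using c by blast
      qed
    qed
    fix E' assume "E' \<in> ?C"
    then obtain F' W' where E': "finite F'" "F' \<subseteq> carrier G" "W' \<in> coarse Y" "E' \<subseteq> cover_rel F' W'"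
      by blast
    show "E \<union> E' \<in> ?C"
    proof (rule C)
      show "finite (F \<union> F')" "F \<union> F' \<subseteq> carrier G" using E E' by auto
      show "W \<union> W' \<in> coarse Y" by (rule coarse_structure_onD(4)[OF coarse_Y E(3) E'(3)])
      have "cover_rel F W \<subseteq> cover_rel (F \<union> F') (W \<union> W')"
        "cover_rel F' W' \<subseteq> cover_rel (F \<union> F') (W \<union> W')"
        by (auto intro!: lift_rel_mono)
      then show "E \<union> E' \<subseteq> cover_rel (F \<union> F') (W \<union> W')"
        using E(4) E'(4) by blast
    qed
    show "E O E' \<in> ?C"
    proof (rule C)
      let ?F = "(\<lambda>(h, h'). h \<otimes> h') ` (F \<times> F')"
      let ?W = "(\<Union>h\<in>F'. translate \<psi> (inv h) W) O W'"
      show "finite ?F" "?F \<subseteq> carrier G" using E(1,2) E'(1,2) by auto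
      show "?W \<in> coarse Y"
        by (rule coarse_structure_onD(6)[OF coarse_Y UN_translate_coarse(2)[OF E'(1,2) E(3)] E'(3)])
      show "E O E' \<subseteq> cover_rel ?F ?W"
      proof
        fix p assume p: "p \<in> E O E'"
        obtain g1 y1 g3 y3 where q: "p = ((g1, y1), (g3, y3))" by (metis surj_pair)
        then obtain g2 y2 where "((g1, y1), (g2, y2)) \<in> cover_rel F W"
          "((g2, y2), (g3, y3)) \<in> cover_rel F' W'"
          using p E(4) E'(4) by fastforce
        then have c: "g1 \<in> carrier G" "y1 \<in> carrier Y" "g2 \<in> carrier G" "y2 \<in> carrier Y"
          "inv g1 \<otimes> g2 \<in> F" "(\<psi> (inv g2) y1, \<psi> (inv g2) y2) \<in> W"
          "g3 \<in> carrier G" "y3 \<in> carrier Y"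
          "inv g2 \<otimes> g3 \<in> F'" "(\<psi> (inv g3) y2, \<psi> (inv g3) y3) \<in> W'"
          unfolding in_lift_rel by auto
        have "(\<psi> (inv (inv g2 \<otimes> g3)) (\<psi> (inv g2) y1), \<psi> (inv (inv g2 \<otimes> g3)) (\<psi> (inv g2) y2))
            \<in> (\<Union>h\<in>F'. translate \<psi> (inv h) W)"
          using c by (intro UN_I[of "inv g2 \<otimes> g3"] translateI) auto
        moreover have "\<psi> (inv (inv g2 \<otimes> g3)) (\<psi> (inv g2) z) = \<psi> (inv g3) z"
          if "z \<in> carrier Y" for z
          using c that by (simp add: inv_mult_group flip: act_mult)
        ultimately have "(\<psi> (inv g3) y1, \<psi> (inv g3) y3) \<in> ?W"
          using c by auto
        moreover have "g2 \<otimes> (inv g2 \<otimes> g3) = g3"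
          using c by (simp flip: m_assoc)
        then have "inv g1 \<otimes> g3 = (inv g1 \<otimes> g2) \<otimes> (inv g2 \<otimes> g3)"
          using c by (simp add: m_assoc)
        then have "inv g1 \<otimes> g3 \<in> ?F"
          using c(5,9) by (intro image_eqI[of _ _ "(inv g1 \<otimes> g2, inv g2 \<otimes> g3)"]) simp_all
        ultimately show "p \<in> cover_rel ?F ?W" unfolding q in_lift_rel using c(1,2,7,8) by simp
      qed
    qed
  qed
  moreover have "{semidirect_entourage G \<psi> Y W | W. W \<in> coarse Y} \<union>
     {{(right_action G Y h a, a) | a. a \<in> carrier G \<times> carrier Y} | h. h \<in> carrier G} \<subseteq> ?C"
  proof
    fix U assume "U \<in> {semidirect_entourage G \<psi> Y W | W. W \<in> coarse Y} \<union>
     {{(right_action G Y h a, a) | a. a \<in> carrier G \<times> carrier Y} | h. h \<in> carrier G}"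
    then show "U \<in> ?C"
    proof (cases rule: cover_generator_cases)
      case (1 W)
      then have "U \<subseteq> cover_rel {\<one>} W" by (auto simp: in_lift_rel)
      then show ?thesis using 1(1) by (intro C[of "{\<one>}" W]) simp_all
    next
      case (2 h)
      then have "U \<subseteq> cover_rel {h} (Id_on (carrier Y))"
        by (auto simp: in_lift_rel inv_mult_group m_assoc)
      then show ?thesis using 2(1) coarse_structure_onD(2)[OF coarse_Y]
        by (intro C[of "{h}" "Id_on (carrier Y)"]) simp_all
    qed
  qed
  ultimately have "coarse cover \<subseteq> ?C"
    unfolding coarse_cover by (intro hull_minimal)
  with assms show ?thesis by blast
qed

subsection \<open>A criterion for branched coarse coverings\<close>

lemma bc_automorphism_action:
  assumes g: "g \<in> carrier G"
  shows "bc_automorphism Y (\<psi> g)"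
proof -
  have bij: "bij_betw (\<psi> g) (carrier Y) (carrier Y)"
    using inj_prop[OF g] surj_prop[OF g] unfolding bij_betw_def by blast
  have inv: "inv_into (carrier Y) (\<psi> g) y = \<psi> (inv g) y" if "y \<in> carrier Y" for y
    using inv_into_f_eq[OF inj_prop[OF g], of "\<psi> (inv g) y" y] g that by simp
  have vimage: "\<psi> g -` B \<inter> carrier Y \<subseteq> \<psi> (inv g) ` B" for B
  proof
    fix y assume y: "y \<in> \<psi> g -` B \<inter> carrier Y"
    then have "y = \<psi> (inv g) (\<psi> g y)" using g by simp
    with y show "y \<in> \<psi> (inv g) ` B" by blast
  qed
  have vimage_inv: "inv_into (carrier Y) (\<psi> g) -` B \<inter> carrier Y \<subseteq> \<psi> g ` B" for B
  proof
    fix y assume y: "y \<in> inv_into (carrier Y) (\<psi> g) -` B \<inter> carrier Y"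
    then have "y = \<psi> g (\<psi> (inv g) y)" "\<psi> (inv g) y \<in> B" using g inv by auto
    then show "y \<in> \<psi> g ` B" by blast
  qed
  have "map_prod (inv_into (carrier Y) (\<psi> g)) (inv_into (carrier Y) (\<psi> g)) ` U
      = translate \<psi> (inv g) U" if U: "U \<in> coarse Y" for U
    unfolding translate_def
  proof (rule image_cong[OF refl])
    fix p assume "p \<in> U"
    then show "map_prod (inv_into (carrier Y) (\<psi> g)) (inv_into (carrier Y) (\<psi> g)) p =
        map_prod (\<psi> (inv g)) (\<psi> (inv g)) p"
      using coarse_carrier[OF U, of "fst p" "snd p"] by (cases p) (simp add: inv)
  qed
  then have "controlled Y Y (inv_into (carrier Y) (\<psi> g))"
    unfolding controlled_def using translate_coarse[of "inv g"] g by simp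
  moreover have "proper_map Y Y (\<psi> g)" "proper_map Y Y (inv_into (carrier Y) (\<psi> g))"
    unfolding proper_map_def
    using bornology_onD(4)[OF bornology_Y image_bounded vimage]
      bornology_onD(4)[OF bornology_Y image_bounded vimage_inv] g by simp_all
  ultimately show ?thesis
    unfolding bc_automorphism_def bc_morphism_def
    using bij controlled_action[OF g] g inv by auto
qed

lemma group_action_deck: "group_action G (carrier G \<times> carrier Y) deck"
proof -
  have inverse: "deck (inv k) (deck k p) = p" "deck k (deck (inv k) p) = p"
    "deck k p \<in> carrier G \<times> carrier Y"
    if "k \<in> carrier G" "p \<in> carrier G \<times> carrier Y" for k p
    using that by (auto simp flip: m_assoc)
  have Bij: "deck k \<in> Bij (carrier G \<times> carrier Y)" if k: "k \<in> carrier G" for k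
  proof -
    have "bij_betw (deck k) (carrier G \<times> carrier Y) (carrier G \<times> carrier Y)"
      using k by (intro bij_betw_byWitness[where f' = "deck (inv k)"] ballI image_subsetI inverse)
        simp_all
    then show ?thesis unfolding Bij_def diagonal_action_def by simp
  qed
  moreover have "deck (k \<otimes> l) = compose (carrier G \<times> carrier Y) (deck k) (deck l)"
    if "k \<in> carrier G" "l \<in> carrier G" for k l
  proof
    fix p
    show "deck (k \<otimes> l) p = compose (carrier G \<times> carrier Y) (deck k) (deck l) p"
      using that by (cases "p \<in> carrier G \<times> carrier Y")
        (auto simp: compose_def m_assoc act_mult diagonal_action_def)
  qed
  ultimately have "deck \<in> hom G (BijGroup (carrier G \<times> carrier Y))"
    unfolding hom_def BijGroup_def by auto
  then show ?thesis
    unfolding group_action_def group_hom_def group_hom_axioms_def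
    using group_BijGroup is_group by blast
qed

text \<open>Feeds the total space back into the locale, so that
  \<open>bc_automorphism_action\<close> also covers the diagonal action.\<close>

lemma bc_action_deck: "bc_action G cover deck"
proof -
  have "controlled cover cover (deck k)" if k: "k \<in> carrier G" for k
    unfolding controlled_def
  proof
    fix U assume U: "U \<in> coarse cover"
    obtain F W where F: "finite F" "F \<subseteq> carrier G" "W \<in> coarse Y" "U \<subseteq> cover_rel F W"
      using cover_rel_subset[OF U] by blast
    have "map_prod (deck k) (deck k) ` U \<subseteq> translate deck k (cover_rel F W)"
      unfolding translate_def by (rule image_mono[OF F(4)])
    also have "\<dots> = cover_rel F W"
      using invariant_lift_rel k unfolding invariant_rel_def by simp
    finally have "map_prod (deck k) (deck k) ` U \<subseteq> cover_rel F W" .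
    then show "map_prod (deck k) (deck k) ` U \<in> coarse cover"
      by (rule coarse_structure_onD(3)[OF coarse_structure_cover cover_rel_coarse[OF F(1-3)]])
  qed
  moreover have "bornological_map cover cover (deck k)" if k: "k \<in> carrier G" for k
    unfolding bornological_map_def
  proof
    fix T assume "T \<in> bornology cover"
    then obtain F B where F: "F \<subseteq> carrier G" "finite F" "B \<in> bornology Y" "T \<subseteq> F \<times> B"
      unfolding bornology_cover by blast
    then have B: "B \<subseteq> carrier Y" using bornology_onD(1)[OF bornology_Y] by blast
    have "deck k ` T \<subseteq> (\<lambda>g. k \<otimes> g) ` F \<times> \<psi> k ` B"
    proof
      fix p assume "p \<in> deck k ` T"
      then obtain g y where p: "(g, y) \<in> T" "p = deck k (g, y)" by auto
      then have gy: "g \<in> F" "y \<in> B" using F(4) by auto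
      then have "p = (k \<otimes> g, \<psi> k y)" using p(2) deck_apply[OF subsetD[OF F(1)] subsetD[OF B]] by simp
      with gy show "p \<in> (\<lambda>g. k \<otimes> g) ` F \<times> \<psi> k ` B" by blast
    qed
    moreover have "(\<lambda>g. k \<otimes> g) ` F \<subseteq> carrier G" "finite ((\<lambda>g. k \<otimes> g) ` F)"
      using F k by auto
    ultimately show "deck k ` T \<in> bornology cover"
      unfolding bornology_cover using image_bounded[OF k F(3)] by blast
  qed
  ultimately show ?thesis
    unfolding bc_action_def bc_action_axioms_def
    using group_action_deck bornological_coarse_cover by simp
qed

text \<open>The entourages \<open>cover_rel F W\<close> are cofinal, and invariant even when
  \<open>W\<close> is not.\<close>

lemma G_bornological_coarse_cover: "G_bornological_coarse G cover deck"
proof -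
  have "\<exists>U'\<in>coarse cover. U \<subseteq> U' \<and> invariant_rel G deck U'" if U: "U \<in> coarse cover" for U
  proof -
    obtain F W where F: "finite F" "F \<subseteq> carrier G" "W \<in> coarse Y" "U \<subseteq> cover_rel F W"
      using cover_rel_subset[OF U] by blast
    show ?thesis
      using cover_rel_coarse[OF F(1-3)] F(4) invariant_lift_rel by (intro bexI conjI)
  qed
  then show ?thesis
    unfolding G_bornological_coarse_def
    using bornological_coarse_cover group_action_deck bc_action.bc_automorphism_action[OF bc_action_deck]
    by simp
qed

text \<open>\<open>R h c' c\<close> declares the point over \<open>h c'\<close> on the sheet shifted by \<open>h\<close> to be the lift next to
  a given point over \<open>c\<close>; the relation \<open>P\<close> required of a branched covering is \<open>lift_rel R\<close>.\<close>

theorem branched_coarse_coveringI: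
  fixes Z :: "'i::order \<Rightarrow> 'y set" and R :: "'a \<Rightarrow> 'y \<Rightarrow> 'y \<Rightarrow> bool"
  assumes f: "\<And>g y. g \<in> carrier G \<Longrightarrow> y \<in> carrier Y \<Longrightarrow> f (g, y) = \<psi> (inv g) y"
    and Z: "big_family base Z"
    and R_large: "\<And>F W. finite F \<Longrightarrow> F \<subseteq> carrier G \<Longrightarrow> W \<in> coarse Y \<Longrightarrow>
      \<exists>i. \<forall>h\<in>F. \<forall>c' c. (c', c) \<in> W \<longrightarrow> c \<notin> Z i \<longrightarrow> R h c' c"
    and R_unique: "\<And>F W. finite F \<Longrightarrow> F \<subseteq> carrier G \<Longrightarrow> W \<in> coarse Y \<Longrightarrow>
      \<exists>i. \<forall>h\<in>F. \<forall>c' c. (c', c) \<in> W \<longrightarrow> c \<notin> Z i \<longrightarrow>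
        (\<forall>k\<in>carrier G. \<forall>d\<in>carrier Y. R k d c \<longrightarrow> \<psi> k d = \<psi> h c' \<longrightarrow> k = h)"
  shows "branched_coarse_covering G cover deck base Z f"
proof -
  have f_closed: "f \<in> carrier cover \<rightarrow> carrier base" using f by auto
  have equivariant: "f (deck k a) = f a" if "k \<in> carrier G" "a \<in> carrier cover" for k a
    using that f by (auto simp: inv_mult_group simp flip: act_mult)
  have controlled: "controlled cover base f"
  proof (rule controlled_generated[OF coarse_cover f_closed])
    show base: "coarse_structure_on (carrier base) (coarse base)"
      by (rule bornological_coarseD(2)[OF bornological_coarse_base])
    fix U assume "U \<in> {semidirect_entourage G \<psi> Y W | W. W \<in> coarse Y} \<union>
      {{(right_action G Y h a, a) | a. a \<in> carrier G \<times> carrier Y} | h. h \<in> carrier G}"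
    then have "U \<subseteq> carrier cover \<times> carrier cover \<and> map_prod f f ` U \<in> coarse base"
    proof (cases rule: cover_generator_cases)
      case (1 W)
      then have "map_prod f f ` U \<subseteq> W" using f by auto
      moreover have "W \<in> coarse base" unfolding coarse_base by (rule hull_inc) (use 1 in blast)
      ultimately have "map_prod f f ` U \<in> coarse base"
        using coarse_structure_onD(3)[OF base, of W] by simp
      then show ?thesis unfolding 1(2) by auto
    next
      case (2 h)
      \<comment> \<open>\<open>f\<close> intertwines right multiplication with the action, so a
        shift of sheets goes to the graph of \<open>\<psi> h\<close>.\<close>
      have "map_prod f f ` U \<subseteq> {(\<psi> h y, y) | y. y \<in> carrier Y}"
        unfolding 2(2) using f 2(1) by (auto simp: inv_mult_group simp flip: act_mult)
      moreover have "{(\<psi> h y, y) | y. y \<in> carrier Y} \<in> coarse base"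
        unfolding coarse_base by (rule hull_inc) (use 2 in blast)
      ultimately have "map_prod f f ` U \<in> coarse base"
        using coarse_structure_onD(3)[OF base, of "{(\<psi> h y, y) | y. y \<in> carrier Y}"] by simp
      then show ?thesis using 2 by auto
    qed
    then show "U \<subseteq> carrier cover \<times> carrier cover" "map_prod f f ` U \<in> coarse base" by blast+
  qed
  have bornological: "bornological_map cover base f"
    unfolding bornological_map_def carrier_base
  proof
    fix T assume "T \<in> bornology cover"
    then obtain F B where F: "F \<subseteq> carrier G" "finite F" "B \<in> bornology Y" "T \<subseteq> F \<times> B"
      unfolding bornology_cover by blast
    then have B: "B \<subseteq> carrier Y" using bornology_onD(1)[OF bornology_Y] by blast
    have "f ` T \<subseteq> (\<Union>g\<in>F. \<psi> (inv g) ` B)"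
    proof
      fix b assume "b \<in> f ` T"
      then obtain g y where "g \<in> F" "y \<in> B" "b = f (g, y)" using F(4) by auto
      moreover from this have "b = \<psi> (inv g) y" using f F(1) B by auto
      ultimately show "b \<in> (\<Union>g\<in>F. \<psi> (inv g) ` B)" by blast
    qed
    moreover have "(\<Union>g\<in>F. \<psi> (inv g) ` B) \<in> bornology Y"
      using F(1-3) by (intro bornology_UN[OF bornology_Y] image_bounded) auto
    ultimately show "f ` T \<in> bornology Y" using bornology_onD(4)[OF bornology_Y] by simp
  qed
  have finite_fibres: "finite (fibre cover f b \<inter> T)" if T: "T \<in> bornology cover" for b T
  proof -
    obtain F B where F: "F \<subseteq> carrier G" "finite F" "B \<in> bornology Y" "T \<subseteq> F \<times> B"
      using T unfolding bornology_cover by blast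
    \<comment> \<open>A point of a fibre is determined by its sheet, and \<open>T\<close> meets
      finitely many sheets.\<close>
    have "fibre cover f b \<inter> T \<subseteq> (\<lambda>g. (g, \<psi> g b)) ` F"
    proof
      fix a assume a: "a \<in> fibre cover f b \<inter> T"
      obtain g y where gy: "a = (g, y)" by (cases a)
      with a have "g \<in> F" "g \<in> carrier G" "y \<in> carrier Y" "f (g, y) = b"
        using F(4) unfolding fibre_def by auto
      moreover from this have "y = \<psi> g b" using f[of g y] by auto
      ultimately show "a \<in> (\<lambda>g. (g, \<psi> g b)) ` F" using gy by blast
    qed
    then show ?thesis using F(2) finite_subset by blast
  qed
  have lifting: "\<exists>i. (\<forall>(b', b) \<in> V \<inter> (carrier base \<times> (carrier base - Z i)).
         \<forall>a\<in>fibre cover f b. \<exists>!a'. a' \<in> fibre cover f b' \<and> (a', a) \<in> lift_rel R) \<and>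
      lift_rel R \<inter> map_prod f f -` (V \<inter> (carrier base \<times> (carrier base - Z i))) \<in> coarse cover"
    if V: "V \<in> coarse base" for V
  proof -
    obtain F W where F: "finite F" "F \<subseteq> carrier G" "W \<in> coarse Y" and VW: "V \<subseteq> base_rel F W"
      using base_rel_subset[OF V] by blast
    obtain i where i: "\<And>h c' c. h \<in> F \<Longrightarrow> (c', c) \<in> W \<Longrightarrow> c \<notin> Z i \<Longrightarrow> R h c' c"
      using R_large[OF F] by blast
    obtain j where j: "\<And>h c' c k d. h \<in> F \<Longrightarrow> (c', c) \<in> W \<Longrightarrow> c \<notin> Z j \<Longrightarrow>
        k \<in> carrier G \<Longrightarrow> d \<in> carrier Y \<Longrightarrow> R k d c \<Longrightarrow> \<psi> k d = \<psi> h c' \<Longrightarrow> k = h"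
      using R_unique[OF F] by blast
    \<comment> \<open>The complement of a larger member of the family is smaller, so outside
      \<open>Z m\<close> lifts both exist and are unique.\<close>
    obtain m where "i \<le> m" "j \<le> m" "mono Z" using Z unfolding big_family_def by blast
    then have m: "Z i \<subseteq> Z m" "Z j \<subseteq> Z m" using monoD[OF \<open>mono Z\<close>] by blast+
    have "\<exists>!a'. a' \<in> fibre cover f b' \<and> (a', a) \<in> lift_rel R"
      if b: "(b', b) \<in> V" "b \<notin> Z m" and a: "a \<in> fibre cover f b" for b' b a
    proof -
      obtain g y where gy: "a = (g, y)" by (cases a)
      have g: "g \<in> carrier G" "y \<in> carrier Y" "\<psi> (inv g) y = b"
        using a f[of g y] unfolding gy fibre_def by auto
      obtain h c where h: "h \<in> F" "(c, b) \<in> W" "b' = \<psi> h c"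
        using b(1) VW unfolding base_rel_def by blast
      then have hG: "h \<in> carrier G" "c \<in> carrier Y" using F(2) coarse_carrier[OF F(3)] by auto
      \<comment> \<open>A shift by \<open>h\<close> forces the sheet \<open>k\<close> with
        \<open>inv k \<otimes> g = h\<close>, that is \<open>g \<otimes> inv h\<close>; the second
        component is \<open>c\<close> carried into the coordinates of the sheet of
        \<open>g\<close>.\<close>
      have "inv (g \<otimes> inv h) \<otimes> g = h" using g hG by (simp add: inv_mult_group m_assoc)
      moreover have "R h c b" using i[OF h(1,2)] b(2) m(1) by blast
      ultimately have "((g \<otimes> inv h, \<psi> g c), (g, y)) \<in> lift_rel R"
        unfolding in_lift_rel using g hG by simp
      moreover have "f (g \<otimes> inv h, \<psi> g c) = b'"
        using f g hG h(3) by (simp add: inv_mult_group flip: act_mult)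
      then have "(g \<otimes> inv h, \<psi> g c) \<in> fibre cover f b'"
        unfolding fibre_def using g hG by simp
      moreover have "a' = (g \<otimes> inv h, \<psi> g c)"
        if a': "a' \<in> fibre cover f b'" "(a', a) \<in> lift_rel R" for a'
      proof -
        obtain k z where kz: "a' = (k, z)" by (cases a')
        have k: "k \<in> carrier G" "z \<in> carrier Y" "\<psi> (inv k) z = b'"
          using a'(1) f[of k z] unfolding kz fibre_def by auto
        have "R (inv k \<otimes> g) (\<psi> (inv g) z) b"
          using a'(2) g(3) unfolding kz gy in_lift_rel by simp
        moreover have eq: "\<psi> (inv k \<otimes> g) (\<psi> (inv g) z) = b'"
          using k g by (simp flip: act_mult)
        ultimately have kh: "inv k \<otimes> g = h"
          using j[OF h(1,2), of "inv k \<otimes> g" "\<psi> (inv g) z"] b(2) m(2) k g h(3) by auto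
        \<comment> \<open>The shift \<open>h\<close> now fixes the sheet, and injectivity of
          \<open>\<psi> h\<close> fixes the remaining component.\<close>
        have "g \<otimes> inv (inv k \<otimes> g) = k" using k g by (simp add: inv_mult_group flip: m_assoc)
        moreover have "\<psi> (inv h) (\<psi> h (\<psi> (inv g) z)) = \<psi> (inv h) (\<psi> h c)"
          using eq h(3) kh by simp
        then have "\<psi> (inv g) z = c" using hG k g by simp
        then have "z = \<psi> g c" using k g by auto
        ultimately show ?thesis unfolding kz using kh by simp
      qed
      ultimately show ?thesis unfolding gy by blast
    qed
    then have "\<forall>(b', b) \<in> V \<inter> (carrier base \<times> (carrier base - Z m)).
         \<forall>a\<in>fibre cover f b. \<exists>!a'. a' \<in> fibre cover f b' \<and> (a', a) \<in> lift_rel R"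
      by blast
    \<comment> \<open>Uniqueness also bounds the restricted relation: a pair of
      \<open>lift_rel R\<close> over a pair of \<open>V\<close> outside \<open>Z m\<close> can only
      have a shift in \<open>F\<close> and a displacement in \<open>W\<close>.\<close>
    moreover have "lift_rel R \<inter> map_prod f f -` (V \<inter> (carrier base \<times> (carrier base - Z m)))
        \<subseteq> cover_rel F W"
    proof
      fix p assume p: "p \<in> lift_rel R \<inter> map_prod f f -` (V \<inter> (carrier base \<times> (carrier base - Z m)))"
      obtain k z g y where q: "p = ((k, z), (g, y))" by (metis surj_pair)
      have c: "k \<in> carrier G" "z \<in> carrier Y" "g \<in> carrier G" "y \<in> carrier Y"
        and Rp: "R (inv k \<otimes> g) (\<psi> (inv g) z) (\<psi> (inv g) y)"
        using p unfolding q by (auto simp: in_lift_rel)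
      have Vp: "(\<psi> (inv k) z, \<psi> (inv g) y) \<in> V" "\<psi> (inv g) y \<notin> Z m"
        using p c f unfolding q by auto
      then obtain h d where h: "h \<in> F" "(d, \<psi> (inv g) y) \<in> W" "\<psi> (inv k) z = \<psi> h d"
        using VW unfolding base_rel_def by blast
      then have hG: "h \<in> carrier G" "d \<in> carrier Y" using F(2) coarse_carrier[OF F(3)] by auto
      have eq: "\<psi> (inv k \<otimes> g) (\<psi> (inv g) z) = \<psi> h d"
        using c h(3) by (simp flip: act_mult)
      then have kh: "inv k \<otimes> g = h"
        using j[OF h(1,2) _ _ _ Rp] Vp(2) m(2) c by auto
      have "\<psi> (inv h) (\<psi> h (\<psi> (inv g) z)) = \<psi> (inv h) (\<psi> h d)" using eq kh by simp
      then have "\<psi> (inv g) z = d" using hG c by simp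
      with h kh show "p \<in> cover_rel F W" unfolding q in_lift_rel using c by simp
    qed
    then have "lift_rel R \<inter> map_prod f f -` (V \<inter> (carrier base \<times> (carrier base - Z m)))
        \<in> coarse cover"
      by (rule coarse_structure_onD(3)[OF coarse_structure_cover cover_rel_coarse[OF F]])
    ultimately show ?thesis by blast
  qed
  have eventually_lift: "\<exists>i. U \<inter> (carrier cover \<times> (f -` (carrier base - Z i) \<inter> carrier cover)) \<subseteq> lift_rel R"
    if U: "U \<in> coarse cover" for U
  proof -
    obtain F W where F: "finite F" "F \<subseteq> carrier G" "W \<in> coarse Y" and UW: "U \<subseteq> cover_rel F W"
      using cover_rel_subset[OF U] by blast
    obtain i where i: "\<And>h c' c. h \<in> F \<Longrightarrow> (c', c) \<in> W \<Longrightarrow> c \<notin> Z i \<Longrightarrow> R h c' c"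
      using R_large[OF F] by blast
    have "U \<inter> (carrier cover \<times> (f -` (carrier base - Z i) \<inter> carrier cover)) \<subseteq> lift_rel R"
    proof
      fix p assume p: "p \<in> U \<inter> (carrier cover \<times> (f -` (carrier base - Z i) \<inter> carrier cover))"
      obtain k z g y where q: "p = ((k, z), (g, y))" by (metis surj_pair)
      have "((k, z), (g, y)) \<in> cover_rel F W" using p UW unfolding q by blast
      then show "p \<in> lift_rel R"
        unfolding q in_lift_rel using i p f[of g y] unfolding q by auto
    qed
    then show ?thesis by blast
  qed
  have sub: "lift_rel R \<subseteq> carrier cover \<times> carrier cover"
    using lift_rel_subset by simp
  show ?thesis
    unfolding branched_coarse_covering_def
    by (intro conjI ballI exI[of _ "lift_rel R"] G_bornological_coarse_cover
        bornological_coarse_base Z f_closed equivariant controlled bornological finite_fibres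
        sub invariant_lift_rel)
      ((rule lifting eventually_lift; assumption) | assumption)+
qed

end

section \<open>The squeezing space\<close>

text \<open>An image under \<open>f\<close> is a preimage under the inverse, which is
  proper.\<close>

lemma bc_automorphism_bornological:
  assumes X: "bornological_coarse X" and f: "bc_automorphism X f"
  shows "bornological_map X X f"
  unfolding bornological_map_def
proof
  fix B assume B: "B \<in> bornology X"
  then have sub: "B \<subseteq> carrier X" using bornology_onD(1)[OF bornological_coarseD(1)[OF X]] by blast
  have bij: "bij_betw f (carrier X) (carrier X)" and
    proper: "inv_into (carrier X) f -` B \<inter> carrier X \<in> bornology X"
    using f B unfolding bc_automorphism_def bc_morphism_def proper_map_def by simp_all
  have "f ` B \<subseteq> inv_into (carrier X) f -` B \<inter> carrier X"
  proof
    fix y assume "y \<in> f ` B"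
    then obtain x where x: "x \<in> B" "y = f x" by blast
    then have "inv_into (carrier X) f y = x" "y \<in> carrier X"
      using sub bij bij_betw_inv_into_left[OF bij] bij_betwE[OF bij] by auto
    with x show "y \<in> inv_into (carrier X) f -` B \<inter> carrier X" by simp
  qed
  then show "f ` B \<in> bornology X" by (rule bornology_onD(4)[OF bornological_coarseD(1)[OF X] proper])
qed

locale adapted_squeezing = X: group_action G "carrier X" \<phi>
  for G (structure) and X :: "('x, 'm) ubc_space_scheme" and \<phi> +
  fixes V :: "(int \<times> 'x) rel"
  assumes X: "uniform_bornological_coarse X"
    and automorphism: "g \<in> carrier G \<Longrightarrow> ubc_automorphism X (\<phi> g)"
    and countable: "countable (carrier G)"
    and free: "uniformly_free G X \<phi>"
    and V: "V \<in> coarse (squeezing X)"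
    and adapted: "adapted G X \<phi> V"
begin

abbreviation (input) "S \<equiv> (UNIV :: int set) \<times> carrier X"
abbreviation (input) "Y \<equiv> coarsely_generated_by (squeezing X) V"
abbreviation (input) "\<psi> \<equiv> squeezing_action X \<phi>"

section \<open>Powers of \<open>V\<close> and the coarse structure they generate\<close>

lemma bornological_coarse_X: "bornological_coarse X"
  and uniform_X: "uniform_structure_on (carrier X) (uniform_ents X)"
  using X unfolding uniform_bornological_coarse_def by simp_all

lemmas bornology_X = bornological_coarseD(1)[OF bornological_coarse_X]

lemma carrier_Y [simp]: "carrier Y = S"
  unfolding coarsely_generated_by_def squeezing_def by simp

lemma coarse_Y: "coarse Y = coarse_generated (carrier Y) {V}"
  unfolding coarsely_generated_by_def squeezing_def by simp

lemma bornology_Y: "bornology Y = {T. \<exists>F B. finite F \<and> B \<in> bornology X \<and> T \<subseteq> F \<times> B}"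
  using bornology_generated_boxes[OF bornology_X, of "UNIV :: int set"]
  unfolding coarsely_generated_by_def squeezing_def by simp

lemma V_subset: "V \<subseteq> S \<times> S"
  using V unfolding squeezing_def by auto

lemma V_control:
  obtains U where "U \<in> coarse X" "V \<subseteq> diag_times U"
  using V unfolding squeezing_def by auto

lemma V_level: "(a, b) \<in> V \<Longrightarrow> fst a = fst b"
  by (rule V_control) (auto simp: diag_times_def)

lemma sym_V: "sym V"
  using adapted unfolding adapted_def by simp

lemma V_scale: "uniform_scale X (\<lambda>n. slice V (int n))"
  using adapted unfolding adapted_def uniformly_wide_def by simp

text \<open>Every slice of \<open>V\<close> is a uniform entourage, by the scale at positive levels
  and by the constant slice at levels \<open>n \<le> 0\<close>; uniform entourages contain the
  diagonal.\<close>

lemma V_refl: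
  assumes "a \<in> S"
  shows "(a, a) \<in> V"
proof -
  have "slice V n \<in> uniform_ents X" for n
  proof (cases "n \<le> 0")
    case True
    then show ?thesis using adapted unfolding adapted_def uniformly_wide_def by auto
  next
    case False
    have "slice V (int (nat n)) \<in> uniform_ents X"
      using V_scale unfolding uniform_scale_def by blast
    moreover have "int (nat n) = n" using False by simp
    ultimately show ?thesis by simp
  qed
  then have "Id_on (carrier X) \<subseteq> slice V (fst a)"
    using uniform_X unfolding uniform_structure_on_def by simp
  moreover have "snd a \<in> carrier X" using assms by auto
  ultimately show ?thesis unfolding slice_def by (cases a) auto
qed

lemma relpow_level: "(a, b) \<in> V ^^ l \<Longrightarrow> fst a = fst b"
  by (induction l arbitrary: b) (auto dest!: V_level)

text \<open>\<open>V ^^ 0\<close> is the identity of the whole type, so a power may relate a point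
  outside \<open>S\<close>, but only to itself. Hence the intersections with
  \<open>S \<times> S\<close> below and the condition \<open>b \<in> S\<close> in
  \<open>relpow_mono\<close>.\<close>

lemma relpow_carrier: "(a, b) \<in> V ^^ l \<Longrightarrow> a \<in> S \<longleftrightarrow> b \<in> S"
proof (induction l arbitrary: b)
  case (Suc l)
  then obtain c where "(a, c) \<in> V ^^ l" "(c, b) \<in> V" by auto
  then show ?case using Suc.IH[of c] V_subset by blast
qed simp

lemma relpow_mono: "(a, b) \<in> V ^^ i \<Longrightarrow> b \<in> S \<Longrightarrow> i \<le> j \<Longrightarrow> (a, b) \<in> V ^^ j"
proof (induction j rule: nat_induct)
  case (Suc j)
  show ?case
  proof (cases "i \<le> j")
    case True
    then show ?thesis using Suc V_refl by (auto intro: relpow_Suc_I)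
  next
    case False
    then show ?thesis using Suc by (simp add: le_Suc_eq)
  qed
qed simp

lemma relpow_sym: "(a, b) \<in> V ^^ l \<Longrightarrow> (b, a) \<in> V ^^ l"
proof (induction l arbitrary: b)
  case (Suc l)
  then obtain c where c: "(a, c) \<in> V ^^ l" "(c, b) \<in> V" by auto
  then have "(b, c) \<in> V" "(c, a) \<in> V ^^ l" using symD[OF sym_V] Suc.IH by blast+
  then show ?case by (rule relpow_Suc_I2)
qed simp

lemma coarse_structure_Y: "coarse_structure_on S (coarse Y)"
  unfolding coarse_Y carrier_Y using V_subset by (intro coarse_structure_on_generated) simp

lemma relpow_coarse: "V ^^ l \<inter> S \<times> S \<in> coarse Y"
proof (induction l)
  case 0
  have "V ^^ 0 \<inter> S \<times> S = Id_on S" by auto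
  then show ?case using coarse_structure_onD(2)[OF coarse_structure_Y] by simp
next
  case (Suc l)
  have "V \<in> coarse Y" unfolding coarse_Y by (rule hull_inc) simp
  then have "(V ^^ l \<inter> S \<times> S) O V \<in> coarse Y"
    by (rule coarse_structure_onD(6)[OF coarse_structure_Y Suc])
  moreover have "V ^^ Suc l \<inter> S \<times> S \<subseteq> (V ^^ l \<inter> S \<times> S) O V"
  proof
    fix p assume p: "p \<in> V ^^ Suc l \<inter> S \<times> S"
    obtain a b where q: "p = (a, b)" by (cases p)
    with p obtain c where "(a, c) \<in> V ^^ l" "(c, b) \<in> V" "a \<in> S" by auto
    moreover from this have "c \<in> S" using V_subset by blast
    ultimately show "p \<in> (V ^^ l \<inter> S \<times> S) O V" unfolding q by blast
  qed
  ultimately show ?case by (rule coarse_structure_onD(3)[OF coarse_structure_Y])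
qed

text \<open>\<open>V\<close> is symmetric and contains the diagonal of \<open>S\<close>, so its
  powers absorb inverses and unions. A coarse entourage is thus controlled by one natural
  number.\<close>

lemma coarse_relpow:
  assumes "E \<in> coarse Y"
  shows "\<exists>l. E \<subseteq> V ^^ l \<inter> S \<times> S"
proof -
  let ?C = "{E. \<exists>l. E \<subseteq> V ^^ l \<inter> S \<times> S}"
  have "coarse_structure_on S ?C"
  proof (rule coarse_structure_onI)
    have "Id_on S \<subseteq> V ^^ 0 \<inter> S \<times> S" by auto
    then show "Id_on S \<in> ?C" by blast
  next
    fix E assume "E \<in> ?C"
    then obtain l where l: "E \<subseteq> V ^^ l \<inter> S \<times> S" by blast
    show "E \<subseteq> S \<times> S" using l by blast
    show "E' \<in> ?C" if "E' \<subseteq> E" for E' using subset_trans[OF that l] by blast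
    have "E\<inverse> \<subseteq> V ^^ l \<inter> S \<times> S" using l relpow_sym by blast
    then show "E\<inverse> \<in> ?C" by blast
    fix E' assume "E' \<in> ?C"
    then obtain l' where l': "E' \<subseteq> V ^^ l' \<inter> S \<times> S" by blast
    have "E \<union> E' \<subseteq> V ^^ (max l l') \<inter> S \<times> S"
    proof
      fix p assume p: "p \<in> E \<union> E'"
      obtain a b where q: "p = (a, b)" by (cases p)
      have "(a, b) \<in> V ^^ l \<or> (a, b) \<in> V ^^ l'" "(a, b) \<in> S \<times> S" using p q l l' by blast+
      then show "p \<in> V ^^ (max l l') \<inter> S \<times> S"
        using relpow_mono[of a b l "max l l'"] relpow_mono[of a b l' "max l l'"] unfolding q by auto
    qed
    then show "E \<union> E' \<in> ?C" by blast
    have "E O E' \<subseteq> V ^^ (l + l') \<inter> S \<times> S"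
      unfolding relpow_add using l l' by blast
    then show "E O E' \<in> ?C" by blast
  qed
  moreover have "V \<subseteq> V ^^ 1 \<inter> S \<times> S" using V_subset by simp
  then have "{V} \<subseteq> ?C" by blast
  ultimately have "coarse Y \<subseteq> ?C" unfolding coarse_Y carrier_Y by (intro hull_minimal)
  with assms show ?thesis by blast
qed

section \<open>The group action on the squeezing space\<close>

lemma squeezing_action_apply [simp]: "x \<in> carrier X \<Longrightarrow> \<psi> g (n, x) = (n, \<phi> g x)"
  unfolding squeezing_action_def by simp

lemma group_action_squeezing: "group_action G S \<psi>"
proof -
  interpret group G using X.group_hom group_hom.axioms(1) by blast
  have closed: "\<phi> g x \<in> carrier X" if "g \<in> carrier G" "x \<in> carrier X" for g x
    using X.element_image that by blast
  have Bij: "\<psi> g \<in> Bij S" if g: "g \<in> carrier G" for g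
  proof -
    have "\<phi> (inv g) (\<phi> g x) = x" "\<phi> g (\<phi> (inv g) x) = x" if "x \<in> carrier X" for x
      using X.orbit_sym_aux[OF g that] X.orbit_sym_aux[of "inv g", OF _ that] g by simp_all
    then have "bij_betw (\<psi> g) S S"
      using g closed by (intro bij_betw_byWitness[where f' = "\<psi> (inv g)"]) auto
    then show ?thesis unfolding Bij_def squeezing_action_def by simp
  qed
  moreover have "\<psi> (g \<otimes> h) = compose S (\<psi> g) (\<psi> h)"
    if "g \<in> carrier G" "h \<in> carrier G" for g h
  proof
    fix p
    show "\<psi> (g \<otimes> h) p = compose S (\<psi> g) (\<psi> h) p"
      using that by (cases p) (simp add: compose_def X.composition_rule closed squeezing_action_def)
  qed
  ultimately have "\<psi> \<in> hom G (BijGroup S)"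
    unfolding hom_def BijGroup_def by auto
  then show ?thesis
    unfolding group_action_def group_hom_def group_hom_axioms_def
    using group_BijGroup is_group by blast
qed

text \<open>The case \<open>l = 1\<close> of adaptedness, the form in which control of the action is
  tested on the generator \<open>V\<close>.\<close>

lemma translate_V:
  assumes "g \<in> carrier G"
  shows "\<exists>k. translate \<psi> g V \<subseteq> V ^^ k"
proof -
  from adapted assms obtain k where "\<forall>l. translate \<psi> g (V ^^ l) \<subseteq> V ^^ (l * k)"
    unfolding adapted_def by blast
  then have "translate \<psi> g (V ^^ 1) \<subseteq> V ^^ (1 * k)" by (rule spec)
  then show ?thesis by auto
qed

sublocale Y: bc_action G Y \<psi>
proof -
  have act: "\<psi> g \<in> S \<rightarrow> S" if "g \<in> carrier G" for g
    using group_action.element_image[OF group_action_squeezing that] by auto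
  have "bornological_coarse Y"
  proof (rule bornological_coarse_generated[OF _ coarse_Y])
    show "bornology_on (carrier Y) (bornology Y)"
      using bornology_on_boxes[OF bornology_X, of "UNIV :: int set"]
      unfolding bornology_Y carrier_Y by simp
    have bounded: "thickening V T \<in> bornology Y" if T: "T \<in> bornology Y" for T
    proof -
      obtain F B where F: "finite F" "B \<in> bornology X" "T \<subseteq> F \<times> B"
        using T unfolding bornology_Y by blast
      obtain U where U: "U \<in> coarse X" "V \<subseteq> diag_times U" by (rule V_control)
      have "thickening V T \<subseteq> F \<times> thickening U B"
        using F(3) U(2) unfolding thickening_def diag_times_def by fast
      moreover have "thickening U B \<in> bornology X"
        by (rule bornological_coarseD(3)[OF bornological_coarse_X U(1) F(2)])
      ultimately show ?thesis unfolding bornology_Y using F(1) by blast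
    qed
    fix U assume "U \<in> {V}"
    then have "U = V" "U\<inverse> = V" using sym_V by (simp_all add: sym_conv_converse_eq)
    then show "U \<subseteq> carrier Y \<times> carrier Y"
      "\<And>T. T \<in> bornology Y \<Longrightarrow> thickening U T \<in> bornology Y"
      "\<And>T. T \<in> bornology Y \<Longrightarrow> thickening (U\<inverse>) T \<in> bornology Y"
      using V_subset bounded by simp_all
  qed
  moreover have "controlled Y Y (\<psi> g)" if g: "g \<in> carrier G" for g
  proof (rule controlled_generated[OF coarse_Y])
    show "\<psi> g \<in> carrier Y \<rightarrow> carrier Y" using act[OF g] by simp
    show "coarse_structure_on (carrier Y) (coarse Y)" using coarse_structure_Y by simp
    fix U assume U: "U \<in> {V}"
    then show "U \<subseteq> carrier Y \<times> carrier Y" using V_subset by simp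
    obtain k where "map_prod (\<psi> g) (\<psi> g) ` V \<subseteq> V ^^ k"
      using translate_V[OF g] unfolding translate_def by blast
    moreover have "map_prod (\<psi> g) (\<psi> g) ` V \<subseteq> S \<times> S"
      using V_subset funcset_mem[OF act[OF g]] by fastforce
    ultimately have "map_prod (\<psi> g) (\<psi> g) ` V \<subseteq> V ^^ k \<inter> S \<times> S" by blast
    then show "map_prod (\<psi> g) (\<psi> g) ` U \<in> coarse Y"
      using coarse_structure_onD(3)[OF coarse_structure_Y relpow_coarse] U by simp
  qed
  moreover have "bornological_map Y Y (\<psi> g)" if g: "g \<in> carrier G" for g
    unfolding bornological_map_def
  proof
    fix T assume "T \<in> bornology Y"
    then obtain F B where F: "finite F" "B \<in> bornology X" "T \<subseteq> F \<times> B"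
      unfolding bornology_Y by blast
    then have B: "B \<subseteq> carrier X" using bornology_onD(1)[OF bornology_X] by blast
    have "bornological_map X X (\<phi> g)"
      using automorphism[OF g] bc_automorphism_bornological[OF bornological_coarse_X]
      unfolding ubc_automorphism_def by blast
    then have "\<phi> g ` B \<in> bornology X" using F(2) unfolding bornological_map_def by blast
    moreover have "\<psi> g ` T \<subseteq> F \<times> \<phi> g ` B"
    proof
      fix p assume "p \<in> \<psi> g ` T"
      then obtain n x where nx: "n \<in> F" "x \<in> B" "p = \<psi> g (n, x)" using F(3) by auto
      then have "p = (n, \<phi> g x)" using B by (simp add: subsetD)
      with nx(1,2) show "p \<in> F \<times> \<phi> g ` B" by simp
    qed
    ultimately show "\<psi> g ` T \<in> bornology Y" unfolding bornology_Y using F(1) by blast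
  qed
  ultimately show "bc_action G Y \<psi>"
    unfolding bc_action_def bc_action_axioms_def using group_action_squeezing by simp
qed

section \<open>Separation of group elements at high levels\<close>

lemma relpow_uniformly_small:
  assumes "U \<in> uniform_ents X"
  shows "\<exists>n0. \<forall>n\<ge>n0. slice (V ^^ l) (int n) \<inter> carrier X \<times> carrier X \<subseteq> U"
  using assms
proof (induction l arbitrary: U)
  case 0
  then have "Id_on (carrier X) \<subseteq> U"
    using uniform_X unfolding uniform_structure_on_def by simp
  moreover have "slice (V ^^ 0) (int n) \<inter> carrier X \<times> carrier X \<subseteq> Id_on (carrier X)" for n
    unfolding slice_def by auto
  ultimately show ?case by blast
next
  case (Suc l)
  \<comment> \<open>Each further factor \<open>V\<close> costs one halving of \<open>U\<close>, so
    the threshold found here depends on the exponent as well as on \<open>U\<close>.\<close>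
  have "\<forall>U\<in>uniform_ents X. \<exists>W\<in>uniform_ents X. W O W \<subseteq> U"
    using uniform_X unfolding uniform_structure_on_def by (elim conjE)
  then obtain W where W: "W \<in> uniform_ents X" "W O W \<subseteq> U"
    using Suc.prems by blast
  obtain n1 where n1: "\<forall>n\<ge>n1. slice (V ^^ l) (int n) \<inter> carrier X \<times> carrier X \<subseteq> W"
    using Suc.IH[OF W(1)] by blast
  have "\<exists>n0. \<forall>n\<ge>n0. slice V (int n) \<subseteq> W"
    using V_scale W(1) unfolding uniform_scale_def by simp
  then obtain n2 where n2: "\<forall>n\<ge>n2. slice V (int n) \<subseteq> W" by blast
  have "slice (V ^^ Suc l) (int n) \<inter> carrier X \<times> carrier X \<subseteq> U" if n: "max n1 n2 \<le> n" for n
  proof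
    fix p assume p: "p \<in> slice (V ^^ Suc l) (int n) \<inter> carrier X \<times> carrier X"
    obtain x y where q: "p = (x, y)" by (cases p)
    with p obtain c where c: "((int n, x), c) \<in> V ^^ l" "(c, (int n, y)) \<in> V" "x \<in> carrier X"
      unfolding slice_def by auto
    obtain m z where mz: "c = (m, z)" by (cases c)
    with c(2) have "m = int n" "z \<in> carrier X" using V_level V_subset by fastforce+
    then have "(x, z) \<in> slice (V ^^ l) (int n) \<inter> carrier X \<times> carrier X" "(z, y) \<in> slice V (int n)"
      using c mz unfolding slice_def by auto
    then have "(x, z) \<in> W" "(z, y) \<in> W" using n1 n2 n by auto
    then show "p \<in> U" unfolding q using W(2) by blast
  qed
  then show ?case by blast
qed

text \<open>The index \<open>i\<close> in \<open>joined\<close> is not bounded: if \<open>i\<close> and \<open>j\<close> are both separated at a level, then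
  so is their maximum, which is what uniqueness of lifts needs.\<close>

definition initial :: "nat \<Rightarrow> 'a set" where
  "initial i = {g \<in> carrier G. to_nat_on (carrier G) g \<le> i}"

text \<open>The exponent is doubled because two candidates within \<open>V ^^ i\<close> of a common
  point are within \<open>V ^^ (2 * i)\<close> of each other. Fixing the level of \<open>d\<close>
  fixes that of \<open>c\<close>, as powers of \<open>V\<close> preserve levels.\<close>

definition separated :: "nat \<Rightarrow> int \<Rightarrow> bool" where
  "separated i n \<longleftrightarrow> (\<forall>h\<in>initial i. \<forall>k\<in>initial i. \<forall>c d.
     (c, d) \<in> V ^^ (2 * i) \<longrightarrow> d \<in> S \<longrightarrow> fst d = n \<longrightarrow> \<psi> h c = \<psi> k d \<longrightarrow> h = k)"

definition joined :: "'a \<Rightarrow> int \<times> 'x \<Rightarrow> int \<times> 'x \<Rightarrow> bool" where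
  "joined h c' c \<longleftrightarrow> (\<exists>i. separated i (fst c) \<and> h \<in> initial i \<and> (c', c) \<in> V ^^ i)"

lemma initial_subset: "initial i \<subseteq> carrier G"
  unfolding initial_def by blast

lemma initial_mono: "i \<le> j \<Longrightarrow> initial i \<subseteq> initial j"
  unfolding initial_def by auto

text \<open>This is where countability enters: it makes the enumeration \<open>to_nat_on\<close>
  injective.\<close>

lemma finite_initial: "finite (initial i)"
proof (rule finite_imageD)
  show "finite (to_nat_on (carrier G) ` initial i)"
    by (rule finite_subset[of _ "{..i}"]) (auto simp: initial_def)
  show "inj_on (to_nat_on (carrier G)) (initial i)"
    by (rule inj_on_subset[OF inj_on_to_nat_on[OF countable] initial_subset])
qed

lemma finite_subset_initial:
  assumes "finite F" "F \<subseteq> carrier G"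
  shows "\<exists>i. F \<subseteq> initial i"
proof -
  obtain i where "\<forall>n\<in>to_nat_on (carrier G) ` F. n \<le> i"
    using assms(1) finite_nat_set_iff_bounded_le by blast
  then have "F \<subseteq> initial i" using assms(2) unfolding initial_def by blast
  then show ?thesis by blast
qed

text \<open>For \<open>h \<noteq> k\<close>, a coincidence \<open>\<psi> h c = \<psi> k d\<close>
  puts a pair \<open>(\<phi> g x, x)\<close> with
  \<open>g = inv h \<otimes> k \<noteq> \<one>\<close> into a slice of \<open>V ^^ (2 * i)\<close>.
  Freeness gives a uniform \<open>U\<close> without such pairs, and high slices lie in
  \<open>U\<close>. Since \<open>initial i\<close> is finite, one level serves all \<open>h\<close>
  and \<open>k\<close>.\<close>

lemma eventually_separated: "\<forall>\<^sub>F n in sequentially. separated i (int n)"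
proof -
  have "\<forall>\<^sub>F n in sequentially. \<forall>c d. (c, d) \<in> V ^^ (2 * i) \<longrightarrow> d \<in> S \<longrightarrow> fst d = int n \<longrightarrow>
      \<psi> h c = \<psi> k d \<longrightarrow> h = k"
    if hk: "h \<in> initial i" "k \<in> initial i" for h k
  proof (cases "h = k")
    case False
    have G: "h \<in> carrier G" "k \<in> carrier G" using hk initial_subset by blast+
    let ?g = "inv h \<otimes> k"
    have g: "?g \<in> carrier G" using G by simp
    have "?g \<noteq> \<one>"
    proof
      assume "?g = \<one>"
      then have "h \<otimes> ?g = h" using G by simp
      then show False using G False by (simp flip: Y.m_assoc)
    qed
    then obtain U where U: "U \<in> uniform_ents X" "U \<inter> {(\<phi> ?g x, x) | x. x \<in> carrier X} = {}"
      using free g unfolding uniformly_free_def by blast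
    obtain n0 where n0: "\<forall>n\<ge>n0. slice (V ^^ (2 * i)) (int n) \<inter> carrier X \<times> carrier X \<subseteq> U"
      using relpow_uniformly_small[OF U(1)] by blast
    have False if n: "n0 \<le> n" and cd: "(c, d) \<in> V ^^ (2 * i)" "d \<in> S" "fst d = int n"
      "\<psi> h c = \<psi> k d" for n c d
    proof -
      have c: "c \<in> S" using relpow_carrier[OF cd(1)] cd(2) by blast
      have "c = \<psi> (inv h) (\<psi> h c)" using Y.act_inv(1)[of h c] G c by simp
      also have "\<dots> = \<psi> ?g d" using cd(2,4) G Y.act_mult[of "inv h" k d] by simp
      finally have "c = \<psi> ?g d" .
      moreover obtain x where x: "d = (int n, x)" "x \<in> carrier X" using cd(2,3) by (cases d) auto
      ultimately have c': "c = (int n, \<phi> ?g x)" by simp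
      then have "(\<phi> ?g x, x) \<in> slice (V ^^ (2 * i)) (int n) \<inter> carrier X \<times> carrier X"
        using cd(1) c x unfolding slice_def by auto
      then have "(\<phi> ?g x, x) \<in> U" using n0 n by blast
      with U(2) x(2) show False by blast
    qed
    then show ?thesis unfolding eventually_sequentially by blast
  qed simp
  then show ?thesis
    unfolding separated_def
    by (intro eventually_ball_finite[OF finite_initial] ballI)
qed

abbreviation (input) "Z \<equiv> \<lambda>n::nat. {..int n} \<times> carrier X"

text \<open>One index measures both the supply of group elements and the exponent, so the larger of
  the indices found for \<open>F\<close> and for \<open>W\<close> dominates both.\<close>

lemma separated_outside:
  assumes "finite F" "F \<subseteq> carrier G" "W \<in> coarse Y"
  shows "\<exists>i N. F \<subseteq> initial i \<and> W \<subseteq> V ^^ i \<inter> S \<times> S \<and>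
    (\<forall>c\<in>S. c \<notin> Z N \<longrightarrow> separated i (fst c))"
proof -
  obtain l where l: "W \<subseteq> V ^^ l \<inter> S \<times> S" using coarse_relpow[OF assms(3)] by blast
  obtain j where j: "F \<subseteq> initial j" using finite_subset_initial[OF assms(1,2)] by blast
  let ?i = "max j l"
  obtain N where N: "\<forall>n\<ge>N. separated ?i (int n)"
    using eventually_separated[of ?i] unfolding eventually_sequentially by blast
  show ?thesis
  proof (intro exI conjI ballI impI)
    show "F \<subseteq> initial ?i" using subset_trans[OF j initial_mono[of j ?i]] by simp
    show "W \<subseteq> V ^^ ?i \<inter> S \<times> S"
    proof
      fix p assume p: "p \<in> W"
      obtain a b where q: "p = (a, b)" by (cases p)
      then have "(a, b) \<in> V ^^ l" "(a, b) \<in> S \<times> S" using p l by blast+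
      then show "p \<in> V ^^ ?i \<inter> S \<times> S" using relpow_mono[of a b l ?i] unfolding q by simp
    qed
    fix c assume "c \<in> S" "c \<notin> Z N"
    \<comment> \<open>Outside \<open>Z N\<close> the level exceeds \<open>N\<close>, hence is
      nonnegative and of the form \<open>int n\<close>, as separation was only obtained
      there.\<close>
    then have "int N < fst c" by (cases c) auto
    then have "N \<le> nat (fst c)" "int (nat (fst c)) = fst c" by simp_all
    then show "separated ?i (fst c)" using N by metis
  qed
qed

lemma joined_large:
  assumes "finite F" "F \<subseteq> carrier G" "W \<in> coarse Y"
  shows "\<exists>N. \<forall>h\<in>F. \<forall>c' c. (c', c) \<in> W \<longrightarrow> c \<notin> Z N \<longrightarrow> joined h c' c"
proof -
  obtain i N where i: "F \<subseteq> initial i" "W \<subseteq> V ^^ i \<inter> S \<times> S"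
    "\<forall>c\<in>S. c \<notin> Z N \<longrightarrow> separated i (fst c)"
    using separated_outside[OF assms] by blast
  have "joined h c' c" if "h \<in> F" "(c', c) \<in> W" "c \<notin> Z N" for h c' c
  proof -
    have "(c', c) \<in> V ^^ i" "c \<in> S" using that(2) i(2) by blast+
    then show ?thesis unfolding joined_def using i(1,3) that(1,3) by blast
  qed
  then show ?thesis by blast
qed

text \<open>The competitors \<open>d\<close> and \<open>c'\<close> are both near \<open>c\<close>,
  with exponents from unrelated sources: \<open>i\<close> from \<open>F\<close> and
  \<open>W\<close>, and \<open>j\<close> hidden in \<open>joined\<close>. The larger index bounds
  both halves of the path from \<open>d\<close> through \<open>c\<close> to \<open>c'\<close> and
  covers both group elements, so separation applies to \<open>d\<close> and
  \<open>c'\<close>.\<close>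

lemma joined_unique:
  assumes "finite F" "F \<subseteq> carrier G" "W \<in> coarse Y"
  shows "\<exists>N. \<forall>h\<in>F. \<forall>c' c. (c', c) \<in> W \<longrightarrow> c \<notin> Z N \<longrightarrow>
    (\<forall>k\<in>carrier G. \<forall>d\<in>carrier Y. joined k d c \<longrightarrow> \<psi> k d = \<psi> h c' \<longrightarrow> k = h)"
proof -
  obtain i N where i: "F \<subseteq> initial i" "W \<subseteq> V ^^ i \<inter> S \<times> S"
    "\<forall>c\<in>S. c \<notin> Z N \<longrightarrow> separated i (fst c)"
    using separated_outside[OF assms] by blast
  have "k = h" if h: "h \<in> F" "(c', c) \<in> W" "c \<notin> Z N" and k: "joined k d c" "\<psi> k d = \<psi> h c'"
    for h c' c k d
  proof -
    have c: "(c', c) \<in> V ^^ i" "c' \<in> S" "c \<in> S" using h(2) i(2) by blast+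
    obtain j where j: "separated j (fst c)" "k \<in> initial j" "(d, c) \<in> V ^^ j"
      using k(1) unfolding joined_def by blast
    let ?m = "max i j"
    have "(c, c') \<in> V ^^ ?m" "(d, c) \<in> V ^^ ?m"
      using relpow_mono[OF relpow_sym[OF c(1)] c(2)] relpow_mono[OF j(3) c(3)] by simp_all
    then have "(d, c') \<in> V ^^ (?m + ?m)" unfolding relpow_add by blast
    then have dc: "(d, c') \<in> V ^^ (2 * ?m)" by (simp only: mult_2)
    have "fst c' = fst c" by (rule relpow_level[OF c(1)])
    have "separated i (fst c)" using i(3) c(3) h(3) by blast
    with j(1) have "separated ?m (fst c)" by (simp add: max_def)
    moreover have "h \<in> initial ?m" "k \<in> initial ?m"
      using h(1) i(1) j(2) initial_mono[of i ?m] initial_mono[of j ?m] by auto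
    ultimately show "k = h"
      using dc c(2) \<open>fst c' = fst c\<close> k(2) unfolding separated_def by blast
  qed
  then show ?thesis by blast
qed

text \<open>Powers of \<open>V\<close> and the action both preserve levels, so thickening does not
  leave a member of the family and \<open>j = i\<close> serves.\<close>

lemma big_family_Z: "big_family (coarse_quotient G \<psi> Y) Z"
  unfolding big_family_def
proof (intro conjI allI ballI)
  show "\<exists>k. i \<le> k \<and> j \<le> k" for i j :: nat by (rule exI[of _ "max i j"]) simp
  show "mono Z" by (rule monoI) auto
  show "Z i \<subseteq> carrier (coarse_quotient G \<psi> Y)" for i by auto
  fix i U assume U: "U \<in> coarse (coarse_quotient G \<psi> Y)"
  obtain F W where F: "F \<subseteq> carrier G" "W \<in> coarse Y" "U \<subseteq> Y.base_rel F W"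
    using Y.base_rel_subset[OF U] by blast
  obtain l where l: "W \<subseteq> V ^^ l \<inter> S \<times> S" using coarse_relpow[OF F(2)] by blast
  have "thickening U (Z i) \<subseteq> Z i"
  proof
    fix a assume "a \<in> thickening U (Z i)"
    then obtain b where b: "b \<in> Z i" "(a, b) \<in> U" unfolding thickening_def by blast
    then obtain h c where h: "h \<in> F" "(c, b) \<in> W" "a = \<psi> h c"
      using F(3) unfolding Y.base_rel_def by blast
    then have c: "(c, b) \<in> V ^^ l" "c \<in> S" using l by blast+
    obtain n x where nx: "c = (n, x)" "x \<in> carrier X" using c(2) by auto
    then have "a = (n, \<phi> h x)" "\<phi> h x \<in> carrier X"
      using h(1,3) F(1) X.element_image[of h x] by auto
    moreover have "n = fst b" using relpow_level[OF c(1)] nx(1) by simp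
    ultimately show "a \<in> Z i" using b(1) by auto
  qed
  then show "\<exists>j. thickening U (Z i) \<subseteq> Z j" by blast
qed

lemma branched_coarse_covering_squeezing:
  "branched_coarse_covering G (coarse_quotient G (right_action G Y) (semidirect G \<psi> Y))
     (diagonal_action G \<psi> Y) (coarse_quotient G \<psi> Y) Z (\<lambda>(g, n, x). (n, \<phi> (inv g) x))"
proof (rule Y.branched_coarse_coveringI[OF _ big_family_Z joined_large joined_unique])
  fix g y assume "g \<in> carrier G" "y \<in> carrier Y"
  then show "(case (g, y) of (g, n, x) \<Rightarrow> (n, \<phi> (inv g) x)) = \<psi> (inv g) y"
    by auto
qed

end

theorem proposition5p14:
  fixes G :: "('g, 'k) monoid_scheme"
    and X :: "('x, 'm) ubc_space_scheme"
    and \<phi> :: "'g \<Rightarrow> 'x \<Rightarrow> 'x"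
    and V :: "(int \<times> 'x) rel"
  assumes "group G"
    and "uniform_bornological_coarse X"
    and "group_action G (carrier X) \<phi>"
    and "\<forall>g\<in>carrier G. ubc_automorphism X (\<phi> g)"
    and "countable (carrier G)"
    and "uniformly_free G X \<phi>"
    and "V \<in> coarse (squeezing X)"
    and "adapted G X \<phi> V"
  shows "let Y = coarsely_generated_by (squeezing X) V;
             \<psi> = squeezing_action X \<phi>
         in branched_coarse_covering G
              (coarse_quotient G (right_action G Y) (semidirect G \<psi> Y))
              (diagonal_action G \<psi> Y)
              (coarse_quotient G \<psi> Y)
              (\<lambda>n::nat. {..int n} \<times> carrier X)
              (\<lambda>(g, n, x). (n, \<phi> (inv\<^bsub>G\<^esub> g) x))"
proof -
  interpret adapted_squeezing G X \<phi> V
    unfolding adapted_squeezing_def adapted_squeezing_axioms_def using assms by simp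
  show ?thesis unfolding Let_def by (rule branched_coarse_covering_squeezing)
qed

end
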